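(* Let $K$ be a field of characteristic zero and let $A_1=K\langle X,Y\mid [Y,X]=1\rangle$ be the first Weyl algebra over $K$. If $x,y\in A_1$ are elements with $[y,x]=1$, then the eigenvector algebra $D(yx)$ is equal to the subalgebra $K\langle x,y\rangle$ of $A_1$. In particular, the set of eigenvalues (in $K$) of the inner derivation $\mathrm{ad}(yx)$ of the Weyl algebra $A_1$ is $\mathbb{Z}$, and, for each $i\in\mathbb{Z}$, the vector space $\{u\in A_1\mid [yx,u]=iu\}$ of eigenvectors for $\mathrm{ad}(yx)$ with eigenvalue $i$ is $K[yx]v_i'$, where $v_i':=x^i$ if $i\ge 0$ and $v_i':=y^{-i}$ if $i<0$.
   Context: For elements $a,b$ of an algebra, $[a,b]:=ab-ba$. For $a\in A_1$, $\mathrm{ad}(a):=[a,\cdot\,]:A_1\to A_1$ is the inner derivation associated with $a$. The eigenvector algebra $D(a)$ of $a$ is the $K$-subalgebra of $A_1$ generated by all the eigenvectors of $\mathrm{ad}(a)$ in $A_1$ (with eigenvalues in $K$). $K\langle x,y\rangle$ denotes the $K$-subalgebra of $A_1$ generated by $x$ and $y$, and $K[yx]$ the $K$-subalgebra generated by $yx$. *)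

theory Defs
  imports
    "HOL-Computational_Algebra.Polynomial"
    "HOL-Library.Poly_Mapping"
begin

section \<open>The free algebra on two generators\<close>

datatype gen = GX | GY

datatype word = Word (letters: "gen list")

text \<open>The free monoid on two letters, written additively because the convolution product of
  \<^theory>\<open>HOL-Library.Poly_Mapping\<close> is taken over a (not necessarily commutative) additive
  monoid. The type \<open>word \<Rightarrow>\<^sub>0 'k\<close> is thus the free unital associative algebra over \<open>'k\<close>.\<close>

instantiation word :: monoid_add
begin

definition "0 = Word []"
definition "v + w = Word (letters v @ letters w)"

instance
  by standard (simp_all add: zero_word_def plus_word_def)

end

abbreviation free_X :: "word \<Rightarrow>\<^sub>0 'k::field"
  where "free_X \<equiv> Poly_Mapping.single (Word [GX]) 1"

abbreviation free_Y :: "word \<Rightarrow>\<^sub>0 'k::field"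
  where "free_Y \<equiv> Poly_Mapping.single (Word [GY]) 1"

definition two_sided_ideal :: "'a::ring_1 set \<Rightarrow> bool"
  where "two_sided_ideal I \<longleftrightarrow>
    0 \<in> I \<and> (\<forall>a\<in>I. \<forall>b\<in>I. a + b \<in> I) \<and> (\<forall>a\<in>I. \<forall>r. r * a \<in> I \<and> a * r \<in> I)"

definition weyl_ideal :: "(word \<Rightarrow>\<^sub>0 'k::field) set"
  where "weyl_ideal = two_sided_ideal hull {free_Y * free_X - free_X * free_Y - 1}"

lemma two_sided_ideal_weyl_ideal: "two_sided_ideal (weyl_ideal :: (word \<Rightarrow>\<^sub>0 'k::field) set)"
  unfolding weyl_ideal_def by (rule hull_in) (auto simp: two_sided_ideal_def)

lemma weyl_ideal_zero: "0 \<in> weyl_ideal"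
  and weyl_ideal_add: "a \<in> weyl_ideal \<Longrightarrow> b \<in> weyl_ideal \<Longrightarrow> a + b \<in> weyl_ideal"
  and weyl_ideal_mult_left: "a \<in> weyl_ideal \<Longrightarrow> r * a \<in> weyl_ideal"
  and weyl_ideal_mult_right: "a \<in> weyl_ideal \<Longrightarrow> a * r \<in> weyl_ideal"
  using two_sided_ideal_weyl_ideal unfolding two_sided_ideal_def by blast+

lemma weyl_ideal_uminus: "a \<in> weyl_ideal \<Longrightarrow> - a \<in> weyl_ideal"
  using weyl_ideal_mult_left[of a "- 1"] by simp

lemma weyl_ideal_diff: "a \<in> weyl_ideal \<Longrightarrow> b \<in> weyl_ideal \<Longrightarrow> a - b \<in> weyl_ideal"
  using weyl_ideal_add[of a "- b"] weyl_ideal_uminus[of b] by simp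


section \<open>Action on polynomials\<close>

text \<open>\<open>X\<close> acts by multiplication with the indeterminate and \<open>Y\<close> by differentiation. This shows
  that the ideal is proper, which the class instance \<open>ring_1\<close> of the quotient requires.\<close>

fun gen_act :: "gen \<Rightarrow> 'k::field poly \<Rightarrow> 'k poly"
  where
    "gen_act GX p = pCons 0 p"
  | "gen_act GY p = pderiv p"

definition word_act :: "word \<Rightarrow> 'k::field poly \<Rightarrow> 'k poly"
  where "word_act w p = foldr gen_act (letters w) p"

definition free_act :: "(word \<Rightarrow>\<^sub>0 'k::field) \<Rightarrow> 'k poly \<Rightarrow> 'k poly"
  where "free_act f p = (\<Sum>w\<in>Poly_Mapping.keys f. smult (Poly_Mapping.lookup f w) (word_act w p))"

lemma word_act_zero [simp]: "word_act 0 p = p"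
  by (simp add: word_act_def zero_word_def)

lemma word_act_plus: "word_act (v + w) p = word_act v (word_act w p)"
  by (simp add: word_act_def plus_word_def)

lemma gen_act_add: "gen_act g (p + q) = gen_act g p + gen_act g q"
  by (cases g) (simp_all add: pderiv_add)

lemma gen_act_smult: "gen_act g (smult c p) = smult c (gen_act g p)"
  by (cases g) (simp_all add: pderiv_smult)

lemma word_act_add: "word_act w (p + q) = word_act w p + word_act w q"
proof -
  have "foldr gen_act l (p + q) = foldr gen_act l p + foldr gen_act l q" for l
    by (induction l) (simp_all add: gen_act_add)
  then show ?thesis by (simp add: word_act_def)
qed

lemma word_act_smult: "word_act w (smult c p) = smult c (word_act w p)"
proof -
  have "foldr gen_act l (smult c p) = smult c (foldr gen_act l p)" for l
    by (induction l) (simp_all add: gen_act_smult)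
  then show ?thesis by (simp add: word_act_def)
qed

lemma word_act_zero_right [simp]: "word_act w 0 = 0"
  using word_act_smult[of w 0 0] by simp

lemma free_act_zero [simp]: "free_act 0 p = 0"
  by (simp add: free_act_def)

lemma free_act_single [simp]: "free_act (Poly_Mapping.single w c) p = smult c (word_act w p)"
  by (simp add: free_act_def)

lemma free_act_add: "free_act (f + g) p = free_act f p + free_act g p"
  unfolding free_act_def
  by (rule setsum_keys_plus_distrib) (simp_all add: smult_add_left)

lemma free_act_add_right: "free_act f (p + q) = free_act f p + free_act f q"
  by (simp add: free_act_def word_act_add smult_add_right sum.distrib)

lemma free_induct [case_names zero add]:
  assumes "P 0" and "\<And>w c f. P f \<Longrightarrow> P (Poly_Mapping.single w c + f)"
  shows "P (f :: 'w \<Rightarrow>\<^sub>0 'k::ring_1)"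
proof (induction f rule: update_induct)
  case const
  show ?case by (rule assms(1))
next
  case (update f a b)
  have "Poly_Mapping.update a b f = Poly_Mapping.single a b + f"
    using update(1) by (intro poly_mapping_eqI)
      (auto simp: lookup_update lookup_add lookup_single when_def in_keys_iff)
  then show ?case using assms(2)[OF update(3)] by simp
qed

lemma free_act_smult: "free_act f (smult c p) = smult c (free_act f p)"
  by (induction f rule: free_induct)
    (simp_all add: free_act_add word_act_smult smult_add_right mult.commute)

lemma free_act_zero_right [simp]: "free_act f 0 = 0"
  by (simp add: free_act_def)

lemma free_act_mult: "free_act (f * g) p = free_act f (free_act g p)"
proof (induction f rule: free_induct)
  case (add w c f)
  have "free_act (Poly_Mapping.single w c * g) p = smult c (word_act w (free_act g p))"
  proof (induction g rule: free_induct)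
    case zero
    show ?case by simp
  next
    case (add v d g)
    then show ?case
      by (simp add: distrib_left free_act_add mult_single word_act_plus word_act_add
          word_act_smult smult_add_right)
  qed
  with add show ?case by (simp add: distrib_right free_act_add)
qed simp

lemma free_act_one [simp]: "free_act 1 p = p"
  by (simp flip: single_one)

lemma free_act_minus: "free_act (f - g) p = free_act f p - free_act g p"
  using free_act_add[of "f - g" g p] by simp

lemma weyl_ideal_act:
  assumes "f \<in> weyl_ideal"
  shows "free_act f p = 0"
proof -
  have "weyl_ideal \<subseteq> {f :: word \<Rightarrow>\<^sub>0 'k::field. \<forall>p. free_act f p = 0}"
    unfolding weyl_ideal_def
  proof (rule hull_minimal)
    show "two_sided_ideal {f :: word \<Rightarrow>\<^sub>0 'k. \<forall>p. free_act f p = 0}"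
      by (auto simp: two_sided_ideal_def free_act_add free_act_mult)
    show "{free_Y * free_X - free_X * free_Y - 1} \<subseteq> {f :: word \<Rightarrow>\<^sub>0 'k. \<forall>p. free_act f p = 0}"
      by (simp add: free_act_minus free_act_mult word_act_def pderiv_pCons)
  qed
  with assms show ?thesis by auto
qed

lemma one_notin_weyl_ideal: "1 \<notin> weyl_ideal"
  using weyl_ideal_act[of 1 1] by auto


section \<open>The first Weyl algebra\<close>

definition weyl_rel :: "(word \<Rightarrow>\<^sub>0 'k::field) \<Rightarrow> (word \<Rightarrow>\<^sub>0 'k) \<Rightarrow> bool"
  where "weyl_rel f g \<longleftrightarrow> f - g \<in> weyl_ideal"

lemma equivp_weyl_rel: "equivp weyl_rel"
proof (rule equivpI)
  show "reflp weyl_rel"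
    by (simp add: reflp_def weyl_rel_def weyl_ideal_zero)
  show "symp weyl_rel"
    unfolding symp_def weyl_rel_def by (metis weyl_ideal_uminus minus_diff_eq)
  show "transp weyl_rel"
    unfolding transp_def weyl_rel_def by (metis weyl_ideal_add diff_add_cancel add_diff_eq)
qed

quotient_type (overloaded) 'k weyl = "word \<Rightarrow>\<^sub>0 ('k::field)" / weyl_rel
  by (rule equivp_weyl_rel)

instantiation weyl :: (field) ring_1
begin

lift_definition zero_weyl :: "'a weyl" is 0 .

lift_definition one_weyl :: "'a weyl" is 1 .

lift_definition plus_weyl :: "'a weyl \<Rightarrow> 'a weyl \<Rightarrow> 'a weyl" is "(+)"
  unfolding weyl_rel_def by (metis weyl_ideal_add add_diff_add)

lift_definition uminus_weyl :: "'a weyl \<Rightarrow> 'a weyl" is uminus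
  unfolding weyl_rel_def by (metis weyl_ideal_uminus minus_diff_minus)

lift_definition minus_weyl :: "'a weyl \<Rightarrow> 'a weyl \<Rightarrow> 'a weyl" is "(-)"
proof -
  fix f f' g g' :: "word \<Rightarrow>\<^sub>0 'a"
  assume "weyl_rel f f'" "weyl_rel g g'"
  then have "(f - f') - (g - g') \<in> weyl_ideal"
    by (simp add: weyl_rel_def weyl_ideal_diff)
  then show "weyl_rel (f - g) (f' - g')"
    by (simp add: weyl_rel_def algebra_simps)
qed

lift_definition times_weyl :: "'a weyl \<Rightarrow> 'a weyl \<Rightarrow> 'a weyl" is "(*)"
proof -
  fix f f' g g' :: "word \<Rightarrow>\<^sub>0 'a"
  assume "weyl_rel f f'" "weyl_rel g g'"
  then have "(f - f') * g + f' * (g - g') \<in> weyl_ideal"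
    by (simp add: weyl_rel_def weyl_ideal_add weyl_ideal_mult_left weyl_ideal_mult_right)
  then show "weyl_rel (f * g) (f' * g')"
    by (simp add: weyl_rel_def left_diff_distrib right_diff_distrib)
qed

instance
proof
  show "(0 :: 'a weyl) \<noteq> 1"
    by transfer (use weyl_ideal_uminus one_notin_weyl_ideal in \<open>force simp: weyl_rel_def\<close>)
qed (transfer; simp add: weyl_rel_def weyl_ideal_zero algebra_simps; fail)+

end

lift_definition weyl_scale :: "'k::field \<Rightarrow> 'k weyl \<Rightarrow> 'k weyl"  (infixr \<open>*\<^sub>W\<close> 75)
  is "\<lambda>c f. Poly_Mapping.single 0 c * f"
  by (simp add: weyl_rel_def weyl_ideal_mult_left flip: right_diff_distrib)

lift_definition weyl_X :: "'k::field weyl" is free_X .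

lift_definition weyl_Y :: "'k::field weyl" is free_Y .

global_interpretation weyl: vector_space "weyl_scale :: 'k::field \<Rightarrow> 'k weyl \<Rightarrow> 'k weyl"
  by standard
    (transfer; simp add: weyl_rel_def weyl_ideal_zero algebra_simps single_add mult_single
      flip: mult.assoc)+

lemma single_zero_commute:
  "Poly_Mapping.single 0 c * f = f * Poly_Mapping.single 0 c"
  for f :: "word \<Rightarrow>\<^sub>0 'k::field"
  by (induction f rule: free_induct)
    (simp_all add: distrib_left distrib_right mult_single mult.commute)

lemma weyl_scale_mult_left: "(c *\<^sub>W u) * v = c *\<^sub>W (u * v)"
  by transfer (simp add: weyl_rel_def weyl_ideal_zero mult.assoc)

lemma weyl_scale_mult_right: "u * (c *\<^sub>W v) = c *\<^sub>W (u * v)"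
  for u v :: "'k::field weyl"
proof transfer
  fix c :: 'k and f g :: "word \<Rightarrow>\<^sub>0 'k"
  have "f * (Poly_Mapping.single 0 c * g) = Poly_Mapping.single 0 c * (f * g)"
    by (metis mult.assoc single_zero_commute)
  then show "weyl_rel (f * (Poly_Mapping.single 0 c * g)) (Poly_Mapping.single 0 c * (f * g))"
    by (simp add: weyl_rel_def weyl_ideal_zero)
qed


section \<open>Commutators, eigenvectors and eigenvector algebras\<close>

definition commutator :: "'a::ring \<Rightarrow> 'a \<Rightarrow> 'a"
  where "commutator a b = a * b - b * a"

lemma commutator_weyl_Y_weyl_X: "commutator weyl_Y weyl_X = (1 :: 'k::field weyl)"
  unfolding commutator_def
  by transfer (simp add: weyl_rel_def weyl_ideal_def hull_inc)

abbreviation (input) ad :: "'k::field weyl \<Rightarrow> 'k weyl \<Rightarrow> 'k weyl"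
  where "ad a \<equiv> commutator a"

definition weyl_subalgebra :: "'k::field weyl set \<Rightarrow> bool"
  where "weyl_subalgebra B \<longleftrightarrow> weyl.subspace B \<and> 1 \<in> B \<and> (\<forall>u\<in>B. \<forall>v\<in>B. u * v \<in> B)"

definition generated_subalgebra :: "'k::field weyl set \<Rightarrow> 'k weyl set"
  where "generated_subalgebra S = weyl_subalgebra hull S"

lemma weyl_subalgebra_generated: "weyl_subalgebra (generated_subalgebra S)"
  unfolding generated_subalgebra_def
  by (rule hull_in) (auto simp: weyl_subalgebra_def weyl.subspace_def)

definition eigenvector :: "('k::field weyl \<Rightarrow> 'k weyl) \<Rightarrow> 'k \<Rightarrow> 'k weyl \<Rightarrow> bool"
  where "eigenvector f c u \<longleftrightarrow> u \<noteq> 0 \<and> f u = c *\<^sub>W u"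

definition eigenvalues :: "('k::field weyl \<Rightarrow> 'k weyl) \<Rightarrow> 'k set"
  where "eigenvalues f = {c. \<exists>u. eigenvector f c u}"

definition eigenvector_algebra :: "'k::field weyl \<Rightarrow> 'k weyl set"
  where "eigenvector_algebra a = generated_subalgebra {u. \<exists>c. eigenvector (ad a) c u}"

definition v' :: "'a::monoid_mult \<Rightarrow> 'a \<Rightarrow> int \<Rightarrow> 'a"
  where "v' x y i = (if i \<ge> 0 then x ^ nat i else y ^ nat (- i))"

end

theory Submission
  imports Defs
begin

text \<open>The Weyl algebra is filtered by the order in \<open>Y\<close>; the leading coefficient of an element is a
  polynomial in \<open>X\<close>. Let \<open>H = y x\<close>. If the order of \<open>H\<close> is at most \<open>1\<close>, then \<open>x\<close> and \<open>y\<close> generate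
  the whole algebra, which is spanned by the eigenvectors \<open>x\<^sup>a y\<^sup>b\<close>. Otherwise the leading coefficient of an
  eigenvector is determined, up to a scalar, by its order. The operator \<open>\<delta> u = [x, u] y\<close>
  preserves the eigenspaces of \<open>ad H\<close>. Comparing \<open>u\<^sup>n\<close> with \<open>H\<^sup>d\<close>, where \<open>n\<close> and \<open>d\<close> are the orders of \<open>H\<close>
  and \<open>u\<close>, shows that \<open>\<delta> u\<close> agrees with \<open>- (d / n) u\<close> up to lower order for \<open>u\<close> in the
  centralizer of \<open>H\<close>. Eigenvalues \<open>c\<close> are rational by a dimension count, so taking powers of \<open>u\<close> times a
  monomial in \<open>x\<close> and \<open>y\<close> extends this to every eigenvector, with \<open>d / n\<close> replaced by
  \<open>e = (d - c ord x) / n\<close>.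

  Induction on the order now shows that every eigenvector \<open>u\<close> is a combination of monomials
  \<open>x\<^sup>a y\<^sup>b\<close>. These satisfy \<open>\<delta> (x\<^sup>a y\<^sup>b) = - b x\<^sup>a y\<^sup>b\<close>, so either \<open>u\<close> has the same leading term
  as one of them, or subtracting a combination of them yields \<open>\<delta> u = - e u\<close>. In the latter case \<open>u\<close>
  commutes with \<open>x\<close> (if \<open>e = 0\<close>), whence \<open>c u = [y, u] x\<close>; or commutes with \<open>y\<close> (if \<open>e = - c\<close>), whence
  \<open>c u = y [x, u]\<close>; or is a multiple of \<open>H - c - e\<close>, because \<open>H u H = y (x u y) x\<close> is. In each case
  the cofactor is an eigenvector of lower order.\<close>

section \<open>Normal forms\<close>

text \<open>Words are built by putting letters in front. Closure under left multiplication by the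
  two generators is therefore enough, and no closure under general products has to be known.\<close>

lemma weyl_left_induct [case_names one add scale X Y]:
  fixes u :: "'k::field weyl"
  assumes one: "P 1"
    and add: "\<And>u v. P u \<Longrightarrow> P v \<Longrightarrow> P (u + v)"
    and scale: "\<And>c u. P u \<Longrightarrow> P (c *\<^sub>W u)"
    and X: "\<And>u. P u \<Longrightarrow> P (weyl_X * u)"
    and Y: "\<And>u. P u \<Longrightarrow> P (weyl_Y * u)"
  shows "P u"
proof -
  have P_0: "P 0" using scale[OF one, of 0] by simp
  have [simp]: "abs_weyl (0 :: word \<Rightarrow>\<^sub>0 'k) = 0" by (simp add: zero_weyl_def)
  have word: "P (abs_weyl (Poly_Mapping.single w 1))" for w
  proof -
    have "P (abs_weyl (Poly_Mapping.single (Word l) 1))" for l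
    proof (induction l)
      case Nil
      show ?case using one
        by (simp add: one_weyl.abs_eq flip: zero_word_def)
    next
      case (Cons g l)
      have "Word (g # l) = Word [g] + Word l"
        by (simp add: plus_word_def)
      then have "(Poly_Mapping.single (Word (g # l)) 1 :: word \<Rightarrow>\<^sub>0 'k)
          = Poly_Mapping.single (Word [g]) 1 * Poly_Mapping.single (Word l) 1"
        by (simp add: mult_single)
      then have "(abs_weyl (Poly_Mapping.single (Word (g # l)) 1) :: 'k weyl)
          = abs_weyl (Poly_Mapping.single (Word [g]) 1) * abs_weyl (Poly_Mapping.single (Word l) 1)"
        by (simp add: times_weyl.abs_eq)
      with Cons X Y show ?case
        by (cases g) (simp_all add: weyl_X.abs_eq weyl_Y.abs_eq)
    qed
    then show ?thesis by (cases w) simp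
  qed
  obtain f where u: "u = abs_weyl f"
    by (metis Quotient_abs_rep Quotient_weyl)
  have "P (abs_weyl f)"
  proof (induction f rule: free_induct)
    case zero
    show ?case using P_0 by simp
  next
    case (add w c f)
    have "abs_weyl (Poly_Mapping.single w c + f)
        = c *\<^sub>W abs_weyl (Poly_Mapping.single w 1) + abs_weyl f"
      by (simp add: plus_weyl.abs_eq weyl_scale.abs_eq mult_single)
    with add word scale assms(2) show ?case by simp
  qed
  with u show ?thesis by simp
qed

section \<open>The action by differential operators\<close>

lift_definition weyl_act :: "'k::field weyl \<Rightarrow> 'k poly \<Rightarrow> 'k poly" is free_act
proof
  fix f g :: "word \<Rightarrow>\<^sub>0 'k" and p
  assume "weyl_rel f g"
  then have "free_act (f - g) p = 0"
    by (simp add: weyl_rel_def weyl_ideal_act)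
  then show "free_act f p = free_act g p"
    by (simp add: free_act_minus)
qed

lemma weyl_act_simps [simp]:
  "weyl_act 0 p = 0"
  "weyl_act u 0 = 0"
  "weyl_act 1 p = p"
  "weyl_act (u + v) p = weyl_act u p + weyl_act v p"
  "weyl_act (u * v) p = weyl_act u (weyl_act v p)"
  "weyl_act (c *\<^sub>W u) p = smult c (weyl_act u p)"
  "weyl_act weyl_X p = pCons 0 p"
  "weyl_act weyl_Y p = pderiv p"
  by (transfer; simp add: free_act_add free_act_mult word_act_def zero_word_def; fail)+

section \<open>Normal forms with \<open>weyl_X\<close> to the left of \<open>weyl_Y\<close>\<close>

definition X_poly :: "'k::field poly \<Rightarrow> 'k weyl"
  where "X_poly p = fold_coeffs (\<lambda>a u. a *\<^sub>W 1 + weyl_X * u) p 0"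

lemma X_poly_0 [simp]: "X_poly 0 = 0"
  by (simp add: X_poly_def)

lemma X_poly_pCons [simp]: "X_poly (pCons a p) = a *\<^sub>W 1 + weyl_X * X_poly p"
  by (cases "p = 0 \<and> a = 0") (auto simp: X_poly_def)

lemma X_poly_1 [simp]: "X_poly 1 = 1"
  by (simp add: one_pCons)

lemma X_poly_add: "X_poly (p + q) = X_poly p + X_poly q"
proof (induction p arbitrary: q)
  case (pCons a p)
  show ?case
    by (cases q, simp add: pCons weyl.scale_left_distrib distrib_left)
qed simp

lemma X_poly_smult: "X_poly (smult c p) = c *\<^sub>W X_poly p"
  by (induction p) (simp_all add: weyl.scale_right_distrib weyl_scale_mult_right)

lemma X_poly_mult: "X_poly (p * q) = X_poly p * X_poly q"
proof (induction p)
  case (pCons a p)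
  then show ?case
    by (simp add: mult_pCons_left X_poly_add X_poly_smult distrib_right weyl_scale_mult_left mult.assoc)
qed simp

lemma weyl_Y_X: "weyl_Y * weyl_X = weyl_X * weyl_Y + (1 :: 'k::field weyl)"
  using commutator_weyl_Y_weyl_X[where ?'k = 'k] by (simp add: commutator_def algebra_simps)

lemma weyl_Y_X_poly: "weyl_Y * X_poly p = X_poly p * weyl_Y + X_poly (pderiv p)"
proof (induction p)
  case (pCons a p)
  have "weyl_Y * X_poly (pCons a p) = a *\<^sub>W weyl_Y + weyl_Y * weyl_X * X_poly p"
    by (simp add: distrib_left weyl_scale_mult_right mult.assoc)
  also have "\<dots> = a *\<^sub>W weyl_Y + weyl_X * (weyl_Y * X_poly p) + X_poly p"
    by (simp add: weyl_Y_X algebra_simps)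
  also have "\<dots> = X_poly (pCons a p) * weyl_Y + X_poly (pderiv (pCons a p))"
    unfolding pCons.IH
    by (simp add: pderiv_pCons X_poly_add algebra_simps weyl_scale_mult_left)
  finally show ?case .
qed simp

lemma weyl_act_X_poly [simp]: "weyl_act (X_poly p) f = p * f"
  by (induction p) (simp_all add: mult_pCons_left)

text \<open>The outer variable stands for \<open>weyl_Y\<close>. Horner recursion multiplies by it
  on the right, so the coefficients, polynomials in \<open>weyl_X\<close>, stay on the left.\<close>

definition from_nf :: "'k::field poly poly \<Rightarrow> 'k weyl"
  where "from_nf P = fold_coeffs (\<lambda>a u. X_poly a + u * weyl_Y) P 0"

lemma from_nf_0 [simp]: "from_nf 0 = 0"
  by (simp add: from_nf_def)

lemma from_nf_pCons [simp]: "from_nf (pCons a P) = X_poly a + from_nf P * weyl_Y"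
  by (cases "P = 0 \<and> a = 0") (auto simp: from_nf_def)

lemma from_nf_add: "from_nf (P + Q) = from_nf P + from_nf Q"
proof (induction P arbitrary: Q)
  case (pCons a P)
  show ?case
    by (cases Q, simp add: pCons X_poly_add distrib_right)
qed simp

lemma from_nf_smult: "from_nf (smult a P) = X_poly a * from_nf P"
  by (induction P) (simp_all add: X_poly_mult distrib_left mult.assoc)

lemma weyl_Y_from_nf: "weyl_Y * from_nf P = from_nf P * weyl_Y + from_nf (map_poly pderiv P)"
proof (induction P)
  case (pCons a P)
  have "weyl_Y * from_nf (pCons a P) = weyl_Y * X_poly a + weyl_Y * from_nf P * weyl_Y"
    by (simp add: algebra_simps)
  also have "\<dots> = from_nf (pCons a P) * weyl_Y + from_nf (map_poly pderiv (pCons a P))"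
    unfolding pCons.IH weyl_Y_X_poly by (simp add: algebra_simps map_poly_pCons)
  finally show ?case .
qed simp

text \<open>Normal forms are stable under left multiplication by both generators, since
  \<open>weyl_Y\<close> passes through one at the cost of differentiating its coefficients.\<close>

lemma surj_from_nf: "surj (from_nf :: _ \<Rightarrow> 'k::field weyl)"
proof -
  have "\<exists>P. u = from_nf P" for u :: "'k weyl"
  proof (induction u rule: weyl_left_induct)
    case one
    show ?case by (rule exI[of _ 1]) (simp add: one_pCons[where ?'a = "'k poly"])
  next
    case (add u v)
    then show ?case by (metis from_nf_add)
  next
    case (scale c u)
    then obtain P where "u = from_nf P" by blast
    then have "c *\<^sub>W u = from_nf (smult [:c:] P)"
      by (simp add: from_nf_smult weyl_scale_mult_left)
    then show ?case by blast
  next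
    case (X u)
    then obtain P where "u = from_nf P" by blast
    then have "weyl_X * u = from_nf (smult [:0, 1:] P)"
      by (simp add: from_nf_smult)
    then show ?case by blast
  next
    case (Y u)
    then obtain P where "u = from_nf P" by blast
    then have "weyl_Y * u = from_nf (pCons 0 P + map_poly pderiv P)"
      by (simp add: from_nf_add weyl_Y_from_nf)
    then show ?case by blast
  qed
  then show ?thesis by (auto simp: surj_def)
qed

lemma surj_pderiv: "surj (pderiv :: 'k::field_char_0 poly \<Rightarrow> _)"
proof -
  have "\<exists>f. pderiv f = g" for g :: "'k poly"
  proof -
    let ?f = "\<Sum>i\<le>degree g. monom (coeff g i / of_nat (Suc i)) (Suc i)"
    have "pderiv ?f = (\<Sum>i\<le>degree g. monom (coeff g i) i)"
      unfolding higher_pderiv_sum[of 1, simplified]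
      by (intro sum.cong) (simp_all add: pderiv_monom field_simps del: of_nat_Suc)
    then show ?thesis by (metis poly_as_sum_of_monoms)
  qed
  then show ?thesis by (metis surjI)
qed

text \<open>Applied to the constant 1, the operator reveals its coefficient free of
  \<open>weyl_Y\<close>. Once this is zero, the remaining cofactor of \<open>weyl_Y\<close> also
  acts as zero, because every polynomial is a derivative in characteristic zero.\<close>

lemma from_nf_eq_0:
  fixes P :: "'k::field_char_0 poly poly"
  assumes "from_nf P = 0"
  shows "P = 0"
proof -
  have "(\<And>f. weyl_act (from_nf P) f = 0) \<Longrightarrow> P = 0"
  proof (induction P)
    case (pCons a P)
    have "a = 0" using pCons.prems[of 1] by simp
    moreover have "weyl_act (from_nf P) g = 0" for g
    proof -
      obtain f where "g = pderiv f" using surj_pderiv by (metis surjD)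
      then show ?thesis using pCons.prems[of f] \<open>a = 0\<close> by simp
    qed
    then have "P = 0" by (rule pCons.IH)
    ultimately show ?case using pCons.hyps by simp
  qed simp
  with assms show ?thesis by simp
qed

definition nf :: "'k::field_char_0 weyl \<Rightarrow> 'k poly poly"
  where "nf = inv from_nf"

lemma from_nf_nf [simp]: "from_nf (nf u) = u"
  by (simp add: nf_def surj_f_inv_f surj_from_nf)

lemma inj_from_nf: "inj (from_nf :: _ \<Rightarrow> 'k::field_char_0 weyl)"
proof (rule injI)
  fix P Q :: "'k poly poly"
  assume "from_nf P = from_nf Q"
  moreover have "from_nf P = from_nf (P - Q) + from_nf Q"
    by (simp flip: from_nf_add)
  ultimately show "P = Q"
    using from_nf_eq_0[of "P - Q"] by simp
qed

lemma nf_from_nf [simp]: "nf (from_nf P) = P"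
  by (simp add: nf_def inj_from_nf)

lemma nf_simps [simp]:
  "nf 0 = 0"
  "nf (u + v) = nf u + nf v"
  "nf (X_poly a * u) = smult a (nf u)"
  "nf (u * weyl_Y) = pCons 0 (nf u)"
  "nf (X_poly a) = [:a:]"
  by (rule injD[OF inj_from_nf], simp add: from_nf_add from_nf_smult; fail)+

lemma nf_scale [simp]: "nf (c *\<^sub>W u) = smult [:c:] (nf u)"
  using nf_simps(3)[of "[:c:]" u] by (simp add: weyl_scale_mult_left)

lemma nf_minus [simp]: "nf (- u) = - nf u"
  using nf_simps(2)[of u "- u"] by (simp add: eq_neg_iff_add_eq_0 add.commute)

lemma nf_diff [simp]: "nf (u - v) = nf u - nf v"
  using nf_simps(2)[of u "- v"] by simp

lemma nf_commutator_Y: "nf (commutator weyl_Y u) = map_poly pderiv (nf u)"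
  using weyl_Y_from_nf[of "nf u"] by (simp add: commutator_def)

lemma nf_eq_0_iff [simp]: "nf u = 0 \<longleftrightarrow> u = 0"
  by (metis from_nf_0 from_nf_nf nf_simps(1))

section \<open>Order and leading coefficients\<close>

definition cf :: "'k::field_char_0 weyl \<Rightarrow> nat \<Rightarrow> 'k poly"
  where "cf u i = coeff (nf u) i"

text \<open>A strict order bound that includes zero, so that cancellation and vanishing commutators
  need no separate cases.\<close>

definition below :: "nat \<Rightarrow> 'k::field_char_0 weyl set"
  where "below k = {u. \<forall>i\<ge>k. cf u i = 0}"

lemma cf_simps [simp]:
  "cf 0 i = 0"
  "cf (u + v) i = cf u i + cf v i"
  "cf (u - v) i = cf u i - cf v i"
  "cf (- u) i = - cf u i"
  "cf (c *\<^sub>W u) i = smult c (cf u i)"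
  "cf (X_poly a * u) i = a * cf u i"
  "cf (u * weyl_Y) 0 = 0"
  "cf (u * weyl_Y) (Suc i) = cf u i"
  "cf (X_poly a) 0 = a"
  "cf (X_poly a) (Suc i) = 0"
  "cf (commutator weyl_Y u) i = pderiv (cf u i)"
  by (simp_all add: cf_def nf_commutator_Y coeff_map_poly)

lemma below_iff: "u \<in> below k \<longleftrightarrow> (\<forall>i\<ge>k. cf u i = 0)"
  by (simp add: below_def)

lemma below_mono: "u \<in> below k \<Longrightarrow> k \<le> l \<Longrightarrow> u \<in> below l"
  by (auto simp: below_iff)

lemma below_intros [intro]:
  "0 \<in> below k"
  "u \<in> below k \<Longrightarrow> v \<in> below k \<Longrightarrow> u + v \<in> below k"
  "u \<in> below k \<Longrightarrow> v \<in> below k \<Longrightarrow> u - v \<in> below k"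
  "u \<in> below k \<Longrightarrow> - u \<in> below k"
  "u \<in> below k \<Longrightarrow> c *\<^sub>W u \<in> below k"
  by (simp_all add: below_iff)

lemma below_0_iff [simp]: "u \<in> below 0 \<longleftrightarrow> u = 0"
  by (auto simp: below_iff cf_def poly_eq_iff simp flip: nf_eq_0_iff)

lemma below_Suc_mult_Y: "u \<in> below k \<Longrightarrow> u * weyl_Y \<in> below (Suc k)"
  unfolding below_iff by (metis Suc_le_D Suc_le_mono cf_simps(8))

lemma below_Suc_cases:
  assumes "u \<in> below (Suc k)"
  obtains a v where "u = X_poly a + v * weyl_Y" "v \<in> below k" "cf u 0 = a"
    "\<And>i. cf u (Suc i) = cf v i"
proof -
  obtain a P where P: "nf u = pCons a P" by (cases "nf u")
  have u: "u = X_poly a + from_nf P * weyl_Y"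
    by (metis P from_nf_nf from_nf_pCons)
  show thesis
  proof (rule that[OF u])
    show "from_nf P \<in> below k"
      using assms by (auto simp: below_iff cf_def P coeff_pCons split: nat.splits)
  qed (simp_all add: cf_def P)
qed

section \<open>Commutators and products at the level of leading coefficients\<close>

lemma commutator_simps:
  "commutator a (u + v) = commutator a u + commutator a v"
  "commutator a (u - v) = commutator a u - commutator a v"
  "commutator (a + b) u = commutator a u + commutator b u"
  "commutator a (u * v) = commutator a u * v + u * commutator a v"
  "commutator (a * b) u = a * commutator b u + commutator a u * b"
  "commutator a 0 = 0"
  "commutator 0 a = 0"
  "commutator a 1 = 0"
  "commutator 1 a = 0"
  "commutator a a = 0"
  for a b u v :: "'a::ring_1"
  by (simp_all add: commutator_def algebra_simps)

lemma commutator_swap: "commutator b a = - commutator a b" for a b :: "'a::ring_1"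
  by (simp add: commutator_def)

lemma commutator_scale [simp]:
  "commutator a (c *\<^sub>W u) = c *\<^sub>W commutator a u"
  "commutator (c *\<^sub>W a) u = c *\<^sub>W commutator a u"
  by (simp_all add: commutator_def weyl_scale_mult_left weyl_scale_mult_right
      weyl.scale_right_diff_distrib)

lemma commutator_X_poly [simp]: "commutator (X_poly a) (X_poly b) = 0"
  by (simp add: commutator_def mult.commute flip: X_poly_mult)

lemma commutator_Y_X_poly: "commutator weyl_Y (X_poly b) = X_poly (pderiv b)"
  by (simp add: commutator_def weyl_Y_X_poly)

lemma below_X_poly_mult: "u \<in> below k \<Longrightarrow> X_poly a * u \<in> below k"
  by (simp add: below_iff)

text \<open>Splitting off the last \<open>weyl_Y\<close> of \<open>u\<close> produces one derivative
  of \<open>b\<close> per step. Bound and top coefficient go through one induction because the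
  coefficient uses the bound. The premise \<open>p = Suc k\<close> names degree \<open>p - 1\<close>
  and claims nothing for \<open>p = 0\<close>.\<close>

lemma below_commutator_X_poly_aux:
  assumes "u \<in> below (Suc p)"
  shows "commutator u (X_poly b) \<in> below p \<and>
    (\<forall>k. p = Suc k \<longrightarrow> cf (commutator u (X_poly b)) k = of_nat p * cf u p * pderiv b)"
  using assms
proof (induction p arbitrary: u b)
  case 0
  from 0 show ?case
    by (rule below_Suc_cases) simp
next
  case (Suc p)
  obtain a v where v: "u = X_poly a + v * weyl_Y" "v \<in> below (Suc p)" "\<And>i. cf u (Suc i) = cf v i"
    using Suc.prems by (rule below_Suc_cases) blast
  have "commutator u (X_poly b) = v * X_poly (pderiv b) + commutator v (X_poly b) * weyl_Y"
    by (simp add: v(1) commutator_simps commutator_Y_X_poly)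
  also have "v * X_poly (pderiv b) = X_poly (pderiv b) * v + commutator v (X_poly (pderiv b))"
    by (simp add: commutator_def)
  finally have eq: "commutator u (X_poly b) = X_poly (pderiv b) * v
        + commutator v (X_poly (pderiv b)) + commutator v (X_poly b) * weyl_Y" .
  have 1: "commutator v (X_poly (pderiv b)) \<in> below p"
    using Suc.IH[OF v(2)] by blast
  have 2: "commutator v (X_poly b) * weyl_Y \<in> below (Suc p)"
    using Suc.IH[OF v(2)] below_Suc_mult_Y by blast
  have 3: "cf (commutator v (X_poly b) * weyl_Y) p = of_nat p * cf v p * pderiv b"
    using Suc.IH[OF v(2)] by (cases p) simp_all
  have 4: "cf (commutator v (X_poly (pderiv b))) p = 0"
    using 1 by (simp add: below_iff)
  show ?case
    unfolding eq
  proof (intro conjI allI impI below_intros)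
    show "X_poly (pderiv b) * v \<in> below (Suc p)"
      using v(2) by (rule below_X_poly_mult)
    show "commutator v (X_poly (pderiv b)) \<in> below (Suc p)"
      using 1 by (rule below_mono) simp
  next
    fix k assume "Suc p = Suc k"
    then show "cf (X_poly (pderiv b) * v + commutator v (X_poly (pderiv b)) +
        commutator v (X_poly b) * weyl_Y) k = of_nat (Suc p) * cf u (Suc p) * pderiv b"
      using 3 4 by (simp add: v(3) algebra_simps)
  qed (rule 2)
qed

lemma below_commutator_X_poly:
  assumes "u \<in> below (Suc p)"
  shows "commutator u (X_poly b) \<in> below p"
  using below_commutator_X_poly_aux[OF assms] by blast

text \<open>Moving a polynomial coefficient of \<open>v\<close> to the left of \<open>u\<close>
  costs only a commutator of lower order, so leading coefficients multiply as if everything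
  commuted.\<close>

lemma below_mult_aux:
  assumes "u \<in> below (Suc p)" "v \<in> below (Suc q)"
  shows "u * v \<in> below (Suc (p + q)) \<and> cf (u * v) (p + q) = cf u p * cf v q"
  using assms(2)
proof (induction q arbitrary: v)
  case 0
  then obtain b where v: "v = X_poly b" "cf v 0 = b"
    by (rule below_Suc_cases) simp
  have uv: "u * v = X_poly b * u + commutator u (X_poly b)"
    by (simp add: v commutator_def)
  have "commutator u (X_poly b) \<in> below p"
    using assms(1) by (rule below_commutator_X_poly)
  moreover from this have "cf (commutator u (X_poly b)) p = 0"
    by (simp add: below_iff)
  ultimately show ?case
    using assms(1) unfolding uv v(2)
    by (auto intro!: below_intros below_X_poly_mult elim: below_mono)
next
  case (Suc q)
  obtain b w where v: "v = X_poly b + w * weyl_Y" "w \<in> below (Suc q)" "\<And>i. cf v (Suc i) = cf w i"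
    using Suc.prems by (rule below_Suc_cases) blast
  have uv: "u * v = X_poly b * u + commutator u (X_poly b) + (u * w) * weyl_Y"
    by (simp add: v(1) commutator_def algebra_simps)
  have "commutator u (X_poly b) \<in> below p"
    using assms(1) by (rule below_commutator_X_poly)
  then have 1: "X_poly b * u + commutator u (X_poly b) \<in> below (Suc p)"
    using assms(1) by (auto intro!: below_intros below_X_poly_mult elim: below_mono)
  then have 2: "cf (X_poly b * u + commutator u (X_poly b)) (p + Suc q) = 0"
    unfolding below_iff by simp
  have 3: "X_poly b * u + commutator u (X_poly b) \<in> below (Suc (p + Suc q))"
    using 1 by (rule below_mono) simp
  have 4: "(u * w) * weyl_Y \<in> below (Suc (p + Suc q))"
    using below_Suc_mult_Y Suc.IH[OF v(2)] by fastforce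
  show ?case
    unfolding uv using below_intros(2)[OF 3 4] 2 Suc.IH[OF v(2)] by (simp add: v(3))
qed

lemma below_mult:
  assumes "u \<in> below (Suc p)" "v \<in> below (Suc q)"
  shows "u * v \<in> below (Suc (p + q))"
  using below_mult_aux[OF assms] by blast

lemma cf_mult:
  assumes "u \<in> below (Suc p)" "v \<in> below (Suc q)"
  shows "cf (u * v) (p + q) = cf u p * cf v q"
  using below_mult_aux[OF assms] by blast

text \<open>Strict bounds \<open>p\<close> and \<open>q\<close> mean orders at most
  \<open>p - 1\<close> and \<open>q - 1\<close>, so \<open>p + q - 1\<close> bounds the product
  strictly. A bound 0 forces a zero factor.\<close>

lemma below_mult':
  assumes "u \<in> below p" "v \<in> below q" "p + q \<le> Suc r"
  shows "u * v \<in> below r"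
proof (cases p)
  case (Suc p')
  show ?thesis
  proof (cases q)
    case (Suc q')
    then show ?thesis
      using below_mult[of u p' v q'] assms \<open>p = Suc p'\<close> by (auto elim: below_mono)
  qed (use assms in auto)
qed (use assms in auto)

text \<open>The top terms cancel, and the next coefficient is the Poisson bracket of the two leading
  symbols, with \<open>weyl_Y\<close> as the momentum variable.\<close>

lemma below_commutator_aux:
  assumes "u \<in> below (Suc p)" "v \<in> below (Suc q)"
  shows "commutator u v \<in> below (p + q) \<and>
    (\<forall>k. Suc k = p + q \<longrightarrow> cf (commutator u v) k
      = of_nat p * cf u p * pderiv (cf v q) - of_nat q * cf v q * pderiv (cf u p))"
  using assms(2)
proof (induction q arbitrary: v)
  case 0
  then obtain b where v: "v = X_poly b" "cf v 0 = b"
    by (rule below_Suc_cases) simp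
  show ?case
    using below_commutator_X_poly_aux[OF assms(1)] unfolding v(2) by (auto simp: v(1))
next
  case (Suc q)
  obtain b w where v: "v = X_poly b + w * weyl_Y" "w \<in> below (Suc q)" "\<And>i. cf v (Suc i) = cf w i"
    using Suc.prems by (rule below_Suc_cases) blast
  define D where "D = commutator weyl_Y u"
  have D: "D \<in> below (Suc p)" "\<And>i. cf D i = pderiv (cf u i)"
    using assms(1) by (simp_all add: D_def below_iff)
  have uv: "commutator u v = commutator u (X_poly b) - w * D + commutator u w * weyl_Y"
    by (simp add: v(1) commutator_simps D_def commutator_swap[of weyl_Y])
  have 1: "commutator u (X_poly b) \<in> below (p + q)"
    using below_commutator_X_poly[OF assms(1)] by (rule below_mono) simp
  have 2: "cf (commutator u (X_poly b)) (p + q) = 0"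
    using 1 by (simp add: below_iff)
  have 3: "w * D \<in> below (Suc (q + p))" "cf (w * D) (q + p) = cf w q * pderiv (cf u p)"
    using below_mult[OF v(2) D(1)] cf_mult[OF v(2) D(1)] by (simp_all add: D(2))
  have 4: "commutator u w * weyl_Y \<in> below (Suc (p + q))"
    using Suc.IH[OF v(2)] below_Suc_mult_Y by blast
  have 5: "cf (commutator u w * weyl_Y) (p + q)
      = of_nat p * cf u p * pderiv (cf w q) - of_nat q * cf w q * pderiv (cf u p)"
    using Suc.IH[OF v(2)] by (cases "p + q") auto
  show ?case
    unfolding uv
  proof (intro conjI allI impI)
    show "commutator u (X_poly b) - w * D + commutator u w * weyl_Y \<in> below (p + Suc q)"
      using 1 3(1) 4 by (auto intro!: below_intros elim: below_mono simp: add.commute)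
  next
    fix k assume "Suc k = p + Suc q"
    then have k: "k = p + q" by simp
    show "cf (commutator u (X_poly b) - w * D + commutator u w * weyl_Y) k
      = of_nat p * cf u p * pderiv (cf v (Suc q)) - of_nat (Suc q) * cf v (Suc q) * pderiv (cf u p)"
      using 2 3(2) 5 by (simp add: k v(3) add.commute[of q] algebra_simps)
  qed
qed

lemma below_commutator:
  assumes "u \<in> below (Suc p)" "v \<in> below (Suc q)"
  shows "commutator u v \<in> below (p + q)"
  using below_commutator_aux[OF assms] by blast

lemma cf_commutator:
  assumes "u \<in> below (Suc p)" "v \<in> below (Suc q)" "Suc k = p + q"
  shows "cf (commutator u v) k
      = of_nat p * cf u p * pderiv (cf v q) - of_nat q * cf v q * pderiv (cf u p)"
  using below_commutator_aux[OF assms(1,2)] assms(3) by blast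

section \<open>Order, leading coefficients and the absence of zero divisors\<close>

definition ord :: "'k::field_char_0 weyl \<Rightarrow> nat"
  where "ord u = degree (nf u)"

abbreviation lc :: "'k::field_char_0 weyl \<Rightarrow> 'k poly"
  where "lc u \<equiv> cf u (ord u)"

lemma lc_eq_0_iff [simp]: "lc u = 0 \<longleftrightarrow> u = 0"
  by (simp add: cf_def ord_def)

lemma below_Suc_ord: "u \<in> below (Suc (ord u))"
  by (simp add: below_iff cf_def ord_def coeff_eq_0)

text \<open>Zero is listed separately because \<open>degree\<close> assigns it order 0.\<close>

lemma below_iff_ord: "u \<in> below k \<longleftrightarrow> u = 0 \<or> ord u < k"
  by (metis below_Suc_ord below_iff below_intros(1) below_mono lc_eq_0_iff Suc_leI not_le)

lemma ord_eqI: "u \<in> below (Suc k) \<Longrightarrow> cf u k \<noteq> 0 \<Longrightarrow> ord u = k"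
  by (metis below_iff below_iff_ord cf_simps(1) less_Suc_eq less_or_eq_imp_le not_less)

text \<open>The leading coefficients of two nonzero elements multiply to a nonzero
  polynomial.\<close>

instance weyl :: (field_char_0) ring_1_no_zero_divisors
proof
  fix u v :: "'a weyl" assume "u \<noteq> 0" "v \<noteq> 0"
  then have "cf (u * v) (ord u + ord v) \<noteq> 0"
    using cf_mult[OF below_Suc_ord below_Suc_ord, of u v] by simp
  then show "u * v \<noteq> 0" by auto
qed

lemma ord_mult: "u \<noteq> 0 \<Longrightarrow> v \<noteq> 0 \<Longrightarrow> ord (u * v) = ord u + ord v"
  using cf_mult[OF below_Suc_ord below_Suc_ord, of u v] below_mult[OF below_Suc_ord below_Suc_ord, of u v]
  by (intro ord_eqI) auto

lemma lc_mult: "lc (u * v) = lc u * lc v"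
  using cf_mult[OF below_Suc_ord below_Suc_ord, of u v]
  by (cases "u = 0 \<or> v = 0") (auto simp: ord_mult)

lemma ord_1 [simp]: "ord (1 :: 'k::field_char_0 weyl) = 0"
  using nf_simps(5)[of "1 :: 'k poly"] by (simp add: ord_def)

lemma ord_power: "u \<noteq> 0 \<Longrightarrow> ord (u ^ k) = k * ord u"
  by (induction k) (simp_all add: ord_mult)

section \<open>Eigenvectors of the inner derivation\<close>

lemma commutator_power_commute:
  assumes "commutator a u = c *\<^sub>W 1"
  shows "commutator a (u ^ k) = (of_nat k * c) *\<^sub>W u ^ (k - 1)"
proof (induction k)
  case (Suc k)
  have "of_nat k *\<^sub>W (u * u ^ (k - 1)) = of_nat k *\<^sub>W u ^ k"
    by (cases k) simp_all
  then have "(of_nat k * c) *\<^sub>W (u * u ^ (k - 1)) = (of_nat k * c) *\<^sub>W u ^ k"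
    by (metis mult.commute weyl.scale_scale)
  then show ?case
    by (simp add: commutator_simps(4) assms Suc weyl_scale_mult_left weyl_scale_mult_right
          weyl.scale_left_distrib distrib_right)
qed (simp add: commutator_simps)

definition eig :: "'k::field_char_0 weyl \<Rightarrow> 'k \<Rightarrow> 'k weyl set"
  where "eig a c = {u. commutator a u = c *\<^sub>W u}"

lemma eig_iff: "u \<in> eig a c \<longleftrightarrow> commutator a u = c *\<^sub>W u"
  by (simp add: eig_def)

lemma eig_intros:
  "0 \<in> eig a c"
  "1 \<in> eig a 0"
  "u \<in> eig a c \<Longrightarrow> v \<in> eig a c \<Longrightarrow> u + v \<in> eig a c"
  "u \<in> eig a c \<Longrightarrow> v \<in> eig a c \<Longrightarrow> u - v \<in> eig a c"
  "u \<in> eig a c \<Longrightarrow> k *\<^sub>W u \<in> eig a c"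
  by (simp_all add: eig_iff commutator_simps weyl.scale_right_distrib weyl.scale_right_diff_distrib
      weyl.scale_left_commute)

lemma subspace_eig: "weyl.subspace (eig a c)"
  by (auto simp: weyl.subspace_def intro: eig_intros)

lemma eig_mult: "u \<in> eig a c \<Longrightarrow> v \<in> eig a d \<Longrightarrow> u * v \<in> eig a (c + d)"
  by (simp add: eig_iff commutator_simps weyl.scale_left_distrib weyl_scale_mult_left weyl_scale_mult_right)

lemma eig_power: "u \<in> eig a c \<Longrightarrow> u ^ k \<in> eig a (of_nat k * c)"
proof (induction k)
  case (Suc k)
  then show ?case using eig_mult[of u a c "u ^ k" "of_nat k * c"] by (simp add: algebra_simps)
qed (simp add: eig_intros)

lemma eig_self: "a \<in> eig a 0"
  by (simp add: eig_iff commutator_simps)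

text \<open>Applying the commutator with \<open>a\<close> minus the scalar \<open>\<mu> t\<close>
  deletes the summand for \<open>t\<close> and rescales every other summand by a nonzero factor,
  which leaves a shorter vanishing sum.\<close>

lemma eig_sum_eq_0:
  assumes "finite S" "inj_on \<mu> S" "\<And>s. s \<in> S \<Longrightarrow> w s \<in> eig a (\<mu> s)" "(\<Sum>s\<in>S. w s) = 0" "s \<in> S"
  shows "w s = 0"
  using assms
proof (induction S arbitrary: w s rule: finite_induct)
  case (insert t S)
  have sum: "w t + (\<Sum>s\<in>S. w s) = 0" using insert by simp
  have "0 = commutator a (w t + (\<Sum>s\<in>S. w s)) - \<mu> t *\<^sub>W (w t + (\<Sum>s\<in>S. w s))"
    unfolding sum by (simp add: commutator_simps)
  also have "commutator a (\<Sum>s\<in>S. w s) = (\<Sum>s\<in>S. \<mu> s *\<^sub>W w s)"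
  proof -
    have "commutator a (\<Sum>s\<in>S. w s) = (\<Sum>s\<in>S. commutator a (w s))"
      by (simp add: commutator_def sum_distrib_left sum_distrib_right sum_subtractf)
    also have "\<dots> = (\<Sum>s\<in>S. \<mu> s *\<^sub>W w s)"
      using insert.prems(2) by (intro sum.cong) (auto simp: eig_iff)
    finally show ?thesis .
  qed
  then have "commutator a (w t + (\<Sum>s\<in>S. w s)) - \<mu> t *\<^sub>W (w t + (\<Sum>s\<in>S. w s))
      = (\<Sum>s\<in>S. \<mu> s *\<^sub>W w s) - \<mu> t *\<^sub>W (\<Sum>s\<in>S. w s)"
    using insert.prems(2)[of t] by (simp add: commutator_simps(1) eig_iff weyl.scale_right_distrib)
  also have "\<dots> = (\<Sum>s\<in>S. (\<mu> s - \<mu> t) *\<^sub>W w s)"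
    by (simp only: weyl.scale_sum_right weyl.scale_left_diff_distrib sum_subtractf)
  finally have *: "(\<Sum>s\<in>S. (\<mu> s - \<mu> t) *\<^sub>W w s) = 0" by simp
  have S: "w s = 0" if "s \<in> S" for s
  proof -
    have "(\<mu> s - \<mu> t) *\<^sub>W w s = 0"
    proof (rule insert.IH[of "\<lambda>s. (\<mu> s - \<mu> t) *\<^sub>W w s"])
      show "(\<mu> s - \<mu> t) *\<^sub>W w s \<in> eig a (\<mu> s)" if "s \<in> S" for s
        using insert.prems(2) that by (intro eig_intros) simp
    qed (use insert.prems(1) * that in simp_all)
    moreover have "\<mu> s \<noteq> \<mu> t"
      using inj_onD[OF insert.prems(1), of s t] insert.hyps that by auto
    ultimately show ?thesis by simp
  qed
  with sum have "w t = 0" by simp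
  with S insert.prems(4) show ?case by auto
qed simp

text \<open>If the family has no repetitions, its image is too large to be independent in the span
  of \<open>B\<close>; a repeated value is itself a relation, with coefficients 1 and -1.\<close>

lemma weyl_linear_relation:
  assumes "finite I" "finite B" "card B < card I" "\<And>i. i \<in> I \<Longrightarrow> f i \<in> weyl.span B"
  shows "\<exists>c :: 'i \<Rightarrow> 'k::field. (\<exists>i\<in>I. c i \<noteq> 0) \<and> (\<Sum>i\<in>I. c i *\<^sub>W f i) = 0"
proof (cases "inj_on f I")
  case True
  have "weyl.dependent (f ` I)"
  proof (rule ccontr)
    assume "\<not> weyl.dependent (f ` I)"
    then have "card (f ` I) \<le> card B"
      using weyl.independent_span_bound[OF assms(2), of "f ` I"] assms(4) by blast
    then show False using assms(3) True by (simp add: card_image)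
  qed
  then obtain c where "\<exists>v\<in>f ` I. c v \<noteq> 0" "(\<Sum>v\<in>f ` I. c v *\<^sub>W v) = 0"
    using weyl.dependent_finite[of "f ` I"] assms(1) by auto
  then show ?thesis
    using True by (intro exI[of _ "c \<circ> f"]) (auto simp: sum.reindex)
next
  case False
  then obtain a b where ab: "a \<in> I" "b \<in> I" "a \<noteq> b" "f a = f b"
    by (auto simp: inj_on_def)
  let ?c = "\<lambda>i. (if i = a then 1 else 0) - (if i = b then 1 else 0) :: 'k"
  have "(\<Sum>i\<in>I. ?c i *\<^sub>W f i) = (\<Sum>i\<in>I. if i = a then f i else 0) - (\<Sum>i\<in>I. if i = b then f i else 0)"
    unfolding sum_subtractf[symmetric]
    by (intro sum.cong) (auto simp: weyl.scale_left_diff_distrib)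
  also have "\<dots> = 0" using assms(1) ab by simp
  finally show ?thesis using ab by (intro exI[of _ ?c]) auto
qed

section \<open>Pairs with commutator 1 and their ordered monomials\<close>

locale weyl_pair =
  fixes x y :: "'k::field_char_0 weyl"
  assumes comm: "commutator y x = 1"
begin

definition H :: "'k weyl"
  where "H = y * x"

definition mon :: "nat \<Rightarrow> nat \<Rightarrow> 'k weyl"
  where "mon a b = x ^ a * y ^ b"

lemma xy: "x * y = H - 1" 
  using comm by (simp add: H_def commutator_def algebra_simps)

lemma nonzero [simp]: "x \<noteq> 0" "y \<noteq> 0" "H \<noteq> 0"
  using comm by (auto simp: H_def commutator_simps)

lemma comm_H_x: "commutator H x = x" and comm_H_y: "commutator H y = - y"
  by (simp_all add: H_def commutator_simps comm commutator_swap[of x y])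

lemma eig_x: "x \<in> eig H 1" and eig_y: "y \<in> eig H (- 1)"
  by (simp_all add: eig_iff comm_H_x comm_H_y weyl.scale_minus_left)

lemma eig_mon: "mon a b \<in> eig H (of_nat a - of_nat b)"
  using eig_mult[OF eig_power[OF eig_x, of a] eig_power[OF eig_y, of b]] by (simp add: mon_def)

lemma comm_y_x_power: "commutator y (x ^ a) = of_nat a *\<^sub>W x ^ (a - 1)"
  using commutator_power_commute[of y x 1 a] by (simp add: comm)

lemma comm_x_y_power: "commutator x (y ^ b) = - (of_nat b *\<^sub>W y ^ (b - 1))"
  using commutator_power_commute[of x y "- 1" b]
  by (simp add: comm commutator_swap[of x y] weyl.scale_minus_left)

lemma x_mon: "x * mon a b = mon (Suc a) b"
  by (simp add: mon_def mult.assoc)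

lemma y_mon: "y * mon a b = mon a (Suc b) + of_nat a *\<^sub>W mon (a - 1) b"
proof -
  have "y * x ^ a = x ^ a * y + of_nat a *\<^sub>W x ^ (a - 1)"
    using comm_y_x_power[of a] by (simp add: commutator_def algebra_simps)
  then have "y * x ^ a * y ^ b = x ^ a * y * y ^ b + of_nat a *\<^sub>W x ^ (a - 1) * y ^ b"
    by (simp add: distrib_right)
  then show ?thesis by (simp add: mon_def mult.assoc weyl_scale_mult_left)
qed

lemma mon_x: "mon a b * x = mon (Suc a) b + of_nat b *\<^sub>W mon a (b - 1)"
proof -
  have "y ^ b * x = x * y ^ b + of_nat b *\<^sub>W y ^ (b - 1)"
    using comm_x_y_power[of b] by (simp add: commutator_def algebra_simps)
  then have "x ^ a * (y ^ b * x) = x ^ a * (x * y ^ b + of_nat b *\<^sub>W y ^ (b - 1))"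
    by simp
  then have "mon a b * x = x ^ a * x * y ^ b + of_nat b *\<^sub>W mon a (b - 1)"
    by (simp add: mon_def mult.assoc distrib_left weyl_scale_mult_right)
  then show ?thesis
    by (simp add: mon_def power_commutes)
qed

lemma H_mon: "H * mon a b = mon (Suc a) (Suc b) + of_nat (Suc a) *\<^sub>W mon a b"
  by (simp add: H_def mult.assoc x_mon y_mon del: of_nat_Suc)

text \<open>On ordered monomials the commutator with \<open>x\<close> acts as minus the derivative
  in \<open>y\<close>, so this is minus the Euler operator in \<open>y\<close>.\<close>

definition \<delta> :: "'k weyl \<Rightarrow> 'k weyl"
  where "\<delta> u = commutator x u * y"

lemma \<delta>_simps:
  "\<delta> 0 = 0"
  "\<delta> (u + v) = \<delta> u + \<delta> v"
  "\<delta> (u - v) = \<delta> u - \<delta> v"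
  "\<delta> (c *\<^sub>W u) = c *\<^sub>W \<delta> u"
  by (simp_all add: \<delta>_def commutator_simps algebra_simps weyl_scale_mult_left)

lemma \<delta>_mon: "\<delta> (mon a b) = - (of_nat b *\<^sub>W mon a b)"
proof -
  have "commutator x (x ^ a) = 0"
    by (simp add: commutator_def power_commutes)
  then have "\<delta> (mon a b) = - (of_nat b *\<^sub>W (x ^ a * (y ^ (b - 1) * y)))"
    by (simp add: \<delta>_def mon_def commutator_simps comm_x_y_power weyl_scale_mult_left
        weyl_scale_mult_right mult.assoc)
  then show ?thesis
    by (cases b) (simp_all add: mon_def power_commutes)
qed

lemma eig_commutator_x: "u \<in> eig H c \<Longrightarrow> commutator x u \<in> eig H (c + 1)"
  using eig_mult[OF eig_x, of u c] eig_mult[OF _ eig_x, of u c] 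
  by (auto simp: commutator_def add.commute intro: eig_intros)

lemma eig_commutator_y: "u \<in> eig H c \<Longrightarrow> commutator y u \<in> eig H (c - 1)"
  using eig_mult[OF eig_y, of u c] eig_mult[OF _ eig_y, of u c] 
  by (auto simp: commutator_def add.commute intro: eig_intros)

lemma eig_\<delta>: "u \<in> eig H c \<Longrightarrow> \<delta> u \<in> eig H c"
  using eig_mult[OF eig_commutator_x eig_y, of u c] by (simp add: \<delta>_def)

lemma ord_H: "ord H = ord x + ord y"
  by (simp add: H_def ord_mult)

lemma ord_mon: "ord (mon a b) = a * ord x + b * ord y"
  by (simp add: mon_def ord_mult ord_power)

lemma mon_nonzero: "mon a b \<noteq> 0"
  by (simp add: mon_def)

text \<open>Elements of order 0 are polynomials in \<open>weyl_X\<close> and commute, which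
  \<open>x\<close> and \<open>y\<close> do not.\<close>

lemma ord_H_pos: "0 < ord H"
proof (rule ccontr)
  assume "\<not> 0 < ord H"
  then have "x \<in> below (Suc 0)" "y \<in> below (Suc 0)"
    by (auto simp: ord_H below_iff_ord)
  then have "commutator y x \<in> below 0"
    using below_commutator[of y 0 x 0] by simp
  then show False using comm by simp
qed

text \<open>The powers of \<open>H\<close> have strictly increasing orders, so the highest
  coefficient of a relation must vanish.\<close>

lemma H_powers_independent:
  assumes "(\<Sum>k\<le>m. c k *\<^sub>W H ^ k) = 0" "k \<le> m"
  shows "c k = 0"
  using assms
proof (induction m arbitrary: k)
  case (Suc m)
  have "(\<Sum>k\<le>m. c k *\<^sub>W H ^ k) \<in> below (Suc (m * ord H))"
  proof -
    have "c k *\<^sub>W H ^ k \<in> below (Suc (m * ord H))" if "k \<le> m" for k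
      using that by (intro below_intros) (simp add: below_iff_ord ord_power less_Suc_eq_le)
    then have "(\<Sum>k\<in>S. c k *\<^sub>W H ^ k) \<in> below (Suc (m * ord H))" if "S \<subseteq> {..m}" for S
      using that by (induction S rule: infinite_finite_induct) (auto intro: below_intros)
    then show ?thesis by blast
  qed
  then have "cf (\<Sum>k\<le>m. c k *\<^sub>W H ^ k) (ord (H ^ Suc m)) = 0"
    using ord_H_pos by (auto simp: below_iff ord_power simp del: power_Suc)
  moreover have "cf (\<Sum>k\<le>Suc m. c k *\<^sub>W H ^ k) (ord (H ^ Suc m)) = 0"
    using Suc.prems(1) by simp
  ultimately have "smult (c (Suc m)) (lc (H ^ Suc m)) = 0"
    by (simp del: power_Suc)
  then have "c (Suc m) = 0" by (simp del: power_Suc)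
  with Suc show ?case by (cases "k = Suc m") auto
qed simp

end

global_interpretation XY: weyl_pair weyl_X weyl_Y
  by standard (rule commutator_weyl_Y_weyl_X)

section \<open>Rational eigenvalues and pairs of low order\<close>

definition box :: "nat \<Rightarrow> 'k::field_char_0 weyl set"
  where "box N = weyl.span ((\<lambda>(i, j). XY.mon i j) ` ({..N} \<times> {..N}))"

lemma mon_in_box: "i \<le> N \<Longrightarrow> j \<le> N \<Longrightarrow> XY.mon i j \<in> box N"
  unfolding box_def by (intro weyl.span_base) auto

lemma subspace_box: "weyl.subspace (box N)"
  by (simp add: box_def)

lemma box_mult_left:
  assumes "\<And>i j. i \<le> N \<Longrightarrow> j \<le> N \<Longrightarrow> v * XY.mon i j \<in> box M" "u \<in> box N"
  shows "v * u \<in> box M"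
proof -
  have "weyl.subspace {u. v * u \<in> box M}"
    using subspace_box[of M]
    by (auto simp: weyl.subspace_def distrib_left weyl_scale_mult_right)
  then have "box N \<subseteq> {u. v * u \<in> box M}"
    unfolding box_def[of N] using assms(1) by (intro weyl.span_minimal) auto
  with assms(2) show ?thesis by auto
qed

lemma box_mono: "N \<le> M \<Longrightarrow> box N \<subseteq> box M"
  unfolding box_def by (intro weyl.span_mono) auto

lemma box_X: "u \<in> box N \<Longrightarrow> weyl_X * u \<in> box (Suc N)"
  by (erule box_mult_left[rotated]) (simp add: XY.x_mon mon_in_box)

lemma box_Y: "u \<in> box N \<Longrightarrow> weyl_Y * u \<in> box (Suc N)"
  by (erule box_mult_left[rotated])
    (simp add: XY.y_mon mon_in_box subspace_box weyl.subspace_add weyl.subspace_scale)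

text \<open>Each generator enlarges a box by one, and these shifts add up along words. The constant
  depends on \<open>v\<close> alone, so powers of \<open>v\<close> cause linear growth.\<close>

lemma box_shift:
  fixes v :: "'k::field_char_0 weyl"
  shows "\<exists>C. \<forall>N. \<forall>u\<in>box N. v * u \<in> box (N + C)"
proof (induction v rule: weyl_left_induct)
  case one
  show ?case by (rule exI[of _ 0]) simp
next
  case (add v w)
  then obtain C D where C: "\<And>N u. u \<in> box N \<Longrightarrow> v * u \<in> box (N + C)"
    and D: "\<And>N u. u \<in> box N \<Longrightarrow> w * u \<in> box (N + D)" by blast
  have "(v + w) * u \<in> box (N + (C + D))" if "u \<in> box N" for u N
  proof -
    have "v * u \<in> box (N + (C + D))" "w * u \<in> box (N + (C + D))"
      using C[OF that] D[OF that] box_mono[of "N + C" "N + (C + D)"] box_mono[of "N + D" "N + (C + D)"]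
      by auto
    then show ?thesis by (simp add: distrib_right subspace_box weyl.subspace_add)
  qed
  then show ?case by blast
next
  case (scale c v)
  then show ?case
    by (simp add: weyl_scale_mult_left) (metis subspace_box weyl.subspace_scale)
next
  case (X v)
  then obtain C where "\<And>N u. u \<in> box N \<Longrightarrow> v * u \<in> box (N + C)" by blast
  then have "\<forall>N. \<forall>u\<in>box N. weyl_X * v * u \<in> box (N + Suc C)"
    by (simp add: mult.assoc box_X)
  then show ?case by blast
next
  case (Y v)
  then obtain C where "\<And>N u. u \<in> box N \<Longrightarrow> v * u \<in> box (N + C)" by blast
  then have "\<forall>N. \<forall>u\<in>box N. weyl_Y * v * u \<in> box (N + Suc C)"
    by (simp add: mult.assoc box_Y)
  then show ?case by blast
qed

lemma box_power:
  assumes "\<And>N u. u \<in> box N \<Longrightarrow> v * u \<in> box (N + C)" "u \<in> box N"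
  shows "v ^ k * u \<in> box (N + k * C)"
  using assms(2)
proof (induction k arbitrary: u N)
  case (Suc k)
  then have "v ^ k * (v * u) \<in> box (N + C + k * C)"
    using assms(1) by blast
  then show ?case by (simp add: power_Suc2 mult.assoc add.assoc del: power_Suc)
qed simp

lemma card_box: "card ((\<lambda>(i, j). XY.mon i j :: 'k::field_char_0 weyl) ` ({..N} \<times> {..N})) \<le> (Suc N)\<^sup>2"
  by (rule order.trans[OF card_image_le]) (simp_all add: card_cartesian_product power2_eq_square)

context weyl_pair
begin

text \<open>If \<open>i + j c\<close> determined \<open>i\<close> and \<open>j\<close>, the elements \<open>H\<^sup>k x\<^sup>i u\<^sup>j\<close> would be linearly
  independent, and there would be cubically many of them in spaces of quadratic dimension.\<close>

lemma eigenvalue_rational: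
  assumes u: "u \<in> eig H c" "u \<noteq> 0"
  obtains (rat) q m p where "q > 0" "of_nat q * c + of_nat m - of_nat p = 0"
proof (rule ccontr)
  assume no: "\<not> thesis"
  have irr: "of_nat q * c + of_nat m \<noteq> of_nat p" if "q > 0" for q p m
    using that no rat[of q m p] by auto
  define \<mu> where "\<mu> = (\<lambda>(i, j). of_nat i + of_nat j * c)"
  have aux: "j = j' \<and> i = i'" if "j \<le> j'" "of_nat i + of_nat j * c = of_nat i' + of_nat j' * c"
    for i j i' j' :: nat
  proof (cases "j = j'")
    case False
    with that have "of_nat (j' - j) * c + of_nat i' = of_nat i" "j' - j > 0"
      by (simp_all add: of_nat_diff algebra_simps)
    with irr show ?thesis by blast
  qed (use that in simp)
  have inj: "inj \<mu>"
    unfolding inj_def \<mu>_def using aux by (metis (mono_tags, lifting) nle_le old.prod.case surj_pair)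
  obtain C1 C2 C3 where C1: "\<And>N w. w \<in> box N \<Longrightarrow> H * w \<in> box (N + C1)"
    and C2: "\<And>N w. w \<in> box N \<Longrightarrow> x * w \<in> box (N + C2)"
    and C3: "\<And>N w. w \<in> box N \<Longrightarrow> u * w \<in> box (N + C3)"
    using box_shift by metis
  have P1: "H ^ k * w \<in> box (N + k * C1)" if "w \<in> box N" for w N k
    using that C1 by (rule box_power[rotated])
  have P2: "x ^ k * w \<in> box (N + k * C2)" if "w \<in> box N" for w N k
    using that C2 by (rule box_power[rotated])
  have P3: "u ^ k * w \<in> box (N + k * C3)" if "w \<in> box N" for w N k
    using that C3 by (rule box_power[rotated])
  \<comment> \<open>\<open>C\<close> is positive, hence \<open>Suc (M * C) \<le> Suc M * C\<close>.
    With \<open>M = C\<^sup>2\<close> the dimension bound \<open>(Suc M * C)\<^sup>2\<close> equals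
    \<open>(M + 1)\<^sup>2 M\<close>, which is less than the number \<open>(M + 1)\<^sup>3\<close>
    of elements \<open>g s\<close>.\<close>
  define C where "C = Suc (C1 + C2 + C3)"
  define M where "M = C\<^sup>2"
  define g where "g = (\<lambda>((i, j), k). H ^ k * (x ^ i * u ^ j))"
  let ?I = "({..M} \<times> {..M}) \<times> {..M}"
  have 1: "g s \<in> box (M * C)" if sI: "s \<in> ?I" for s
  proof -
    obtain i j k where s: "s = ((i, j), k)" "i \<le> M" "j \<le> M" "k \<le> M"
      using sI by auto
    have "XY.mon 0 0 \<in> box 0" by (rule mon_in_box) simp_all
    then have "1 \<in> box 0" by (simp add: XY.mon_def)
    then have "u ^ j * 1 \<in> box (0 + j * C3)"
      by (rule P3)
    then have "x ^ i * (u ^ j * 1) \<in> box (0 + j * C3 + i * C2)"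
      by (rule P2)
    then have "H ^ k * (x ^ i * (u ^ j * 1)) \<in> box (0 + j * C3 + i * C2 + k * C1)"
      by (rule P1)
    moreover have "0 + j * C3 + i * C2 + k * C1 \<le> M * C3 + M * C2 + M * C1"
      using s by (simp add: add_mono mult_le_mono1)
    then have "0 + j * C3 + i * C2 + k * C1 \<le> M * C"
      by (simp add: C_def algebra_simps)
    ultimately show ?thesis
      using box_mono by (auto simp: s(1) g_def)
  qed
  have 2: "card ((\<lambda>(i, j). XY.mon i j :: 'k weyl) ` ({..M * C} \<times> {..M * C})) < card ?I"
  proof -
    have "Suc (M * C) \<le> Suc M * C"
      by (simp add: C_def)
    then have "(Suc (M * C))\<^sup>2 \<le> (Suc M * C)\<^sup>2"
      by (rule power_mono) simp
    also have "\<dots> = Suc M * Suc M * M"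
      by (simp add: M_def power2_eq_square algebra_simps)
    also have "\<dots> < Suc M * Suc M * Suc M"
      by (intro mult_strict_left_mono) simp_all
    also have "\<dots> = card ?I"
      by (simp add: card_cartesian_product)
    finally show ?thesis using card_box[of "M * C"] by (rule le_less_trans[rotated])
  qed
  obtain d where d: "\<exists>s\<in>?I. d s \<noteq> 0" "(\<Sum>s\<in>?I. d s *\<^sub>W g s) = 0"
    using weyl_linear_relation[OF _ _ 2, of g] 1 unfolding box_def by auto
  \<comment> \<open>Terms are grouped by \<open>r = (i, j)\<close>. The groups have distinct
    eigenvalues \<open>\<mu> r\<close>, so each is zero; cancelling the nonzero factor
    \<open>x ^ i * u ^ j\<close> leaves a relation among powers of \<open>H\<close>.\<close>
  define w where "w = (\<lambda>r. (\<Sum>k\<le>M. d (r, k) *\<^sub>W H ^ k) * (x ^ fst r * u ^ snd r))"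
  have "(\<Sum>r\<in>{..M} \<times> {..M}. w r) = (\<Sum>s\<in>?I. d s *\<^sub>W g s)"
    unfolding sum.cartesian_product'[of _ "{..M} \<times> {..M}" "{..M}"] w_def g_def
    by (intro sum.cong) (auto simp: sum_distrib_right weyl_scale_mult_left)
  then have sum: "(\<Sum>r\<in>{..M} \<times> {..M}. w r) = 0"
    using d(2) by simp
  have weig: "w r \<in> eig H (\<mu> r)" for r
  proof -
    have "H ^ k \<in> eig H 0" for k
      using eig_power[OF eig_self, of H k] by simp
    then have "(\<Sum>k\<le>M. d (r, k) *\<^sub>W H ^ k) \<in> eig H 0"
      by (intro weyl.subspace_sum[OF subspace_eig] eig_intros)
    moreover have "x ^ fst r * u ^ snd r \<in> eig H (\<mu> r)"
      using eig_mult[OF eig_power[OF eig_x] eig_power[OF u(1)], of "fst r" "snd r"]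
      by (simp add: \<mu>_def case_prod_beta)
    ultimately show ?thesis
      unfolding w_def using eig_mult by fastforce
  qed
  have "d (r, k) = 0" if "r \<in> {..M} \<times> {..M}" "k \<le> M" for r k
  proof -
    have "w r = 0"
      using sum that(1) inj by (intro eig_sum_eq_0[of _ \<mu> w H]) (auto simp: weig inj_def inj_on_def)
    then have "(\<Sum>k\<le>M. d (r, k) *\<^sub>W H ^ k) = 0"
      using u(2) by (simp add: w_def)
    then show ?thesis using that(2) by (rule H_powers_independent)
  qed
  with d(1) show False by auto
qed

section \<open>Homogeneous parts of combinations of monomials\<close>

definition mspan :: "'k \<Rightarrow> 'k weyl set"
  where "mspan c = weyl.span {mon a b | a b. of_nat a - of_nat b = c}"

lemma mon_mult_left_closed:
  shows "w \<in> weyl.span (range (case_prod mon)) \<Longrightarrow> x * w \<in> weyl.span (range (case_prod mon))"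
    and "w \<in> weyl.span (range (case_prod mon)) \<Longrightarrow> y * w \<in> weyl.span (range (case_prod mon))"
proof -
  let ?B = "weyl.span (range (case_prod mon))"
  have mon: "mon a b \<in> ?B" for a b
    using weyl.span_base[of "mon a b" "range (case_prod mon)"] by (metis case_prod_conv rangeI)
  have *: "v * w \<in> ?B" if "\<And>a b. v * mon a b \<in> ?B" "w \<in> ?B" for v w
  proof -
    have "weyl.subspace {w. v * w \<in> ?B}"
      by (auto simp: weyl.subspace_def distrib_left weyl_scale_mult_right weyl.span_zero
          intro: weyl.span_add weyl.span_scale)
    then have "?B \<subseteq> {w. v * w \<in> ?B}"
      using that(1) by (intro weyl.span_minimal) auto
    with that(2) show ?thesis by auto
  qed
  show "w \<in> ?B \<Longrightarrow> x * w \<in> ?B" "w \<in> ?B \<Longrightarrow> y * w \<in> ?B"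
    by (rule *; simp add: x_mon y_mon mon weyl.span_add weyl.span_scale)+
qed

lemma span_mon_decomposition:
  assumes "u \<in> weyl.span (range (case_prod mon))"
  shows "\<exists>S w. finite S \<and> (\<forall>c. w c \<in> mspan c) \<and> (\<forall>c. c \<notin> S \<longrightarrow> w c = 0) \<and> u = (\<Sum>c\<in>S. w c)"
  using assms
proof (induction rule: weyl.span_induct_alt)
  case base
  show "\<exists>S w. finite S \<and> (\<forall>c. w c \<in> mspan c) \<and> (\<forall>c. c \<notin> S \<longrightarrow> w c = 0) \<and> 0 = (\<Sum>c\<in>S. w c)"
    by (rule exI[of _ "{}"], rule exI[of _ "\<lambda>_. 0"]) (simp add: mspan_def weyl.span_zero)
next
  case (step k m v)
  then obtain a b S w where m: "m = mon a b" and w: "finite S" "\<And>c. w c \<in> mspan c"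
    "\<And>c. c \<notin> S \<Longrightarrow> w c = 0" "v = (\<Sum>c\<in>S. w c)"
    by auto
  define d :: 'k where "d = of_nat a - of_nat b"
  define w' where "w' = w (d := k *\<^sub>W m + w d)"
  have "m \<in> mspan d"
    unfolding mspan_def m d_def by (intro weyl.span_base) auto
  then have "w' c \<in> mspan c" for c
    using w(2)[of c] by (auto simp: w'_def mspan_def intro: weyl.span_add weyl.span_scale)
  moreover have "v = (\<Sum>c\<in>insert d S. w c)"
    using w(1,3,4) by (cases "d \<in> S") (simp_all add: insert_absorb)
  then have "k *\<^sub>W m + v = (\<Sum>c\<in>insert d S. w' c)"
    using w(1) by (simp add: w'_def sum.insert_remove[of S] add.assoc)
  moreover have "w' c = 0" if "c \<notin> insert d S" for c
    using w(3) that by (simp add: w'_def)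
  ultimately show "\<exists>S w. finite S \<and> (\<forall>c. w c \<in> mspan c) \<and> (\<forall>c. c \<notin> S \<longrightarrow> w c = 0) \<and> k *\<^sub>W m + v = (\<Sum>c\<in>S. w c)"
    using w(1) by (intro exI[of _ "insert d S"] exI[of _ w']) auto
qed

lemma mspan_subset_eig: "mspan c \<subseteq> eig H c"
  unfolding mspan_def using eig_mon by (intro weyl.span_minimal subspace_eig) auto

text \<open>Subtracting \<open>u\<close> from its own homogeneous part of weight \<open>c\<close>
  gives a vanishing sum of eigenvectors with distinct eigenvalues, so that part is
  \<open>u\<close>.\<close>

lemma eig_span_mon:
  assumes "u \<in> eig H c" "u \<in> weyl.span (range (case_prod mon))"
  shows "u \<in> mspan c"
proof -
  obtain S w where w: "finite S" "\<And>c. w c \<in> mspan c" "\<And>c. c \<notin> S \<Longrightarrow> w c = 0" "u = (\<Sum>c\<in>S. w c)"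
    using span_mon_decomposition[OF assms(2)] by blast
  have "(\<Sum>d\<in>insert c S. (w d - (if d = c then u else 0))) = (\<Sum>d\<in>insert c S. w d) - u"
    using w(1) by (simp add: sum_subtractf)
  also have "(\<Sum>d\<in>insert c S. w d) = u"
    using w by (cases "c \<in> S") (simp_all add: insert_absorb)
  finally have "(\<Sum>d\<in>insert c S. (w d - (if d = c then u else 0))) = 0" by simp
  then have "w c - (if c = c then u else 0) = 0"
  proof (rule eig_sum_eq_0[of "insert c S" id _ H, rotated 3])
    show "w d - (if d = c then u else 0) \<in> eig H (id d)" for d
      using assms(1) w(2)[of d] mspan_subset_eig[of d] by (auto intro: eig_intros)
  qed (use w(1) in simp_all)
  then have "w c = u" by simp
  with w(2)[of c] show ?thesis by simp
qed

end

section \<open>Pairs for which \<open>ord H\<close> is at most one\<close>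

definition left_stabilizer :: "'k::field weyl set \<Rightarrow> 'k weyl set"
  where "left_stabilizer B = {v. \<forall>w\<in>B. v * w \<in> B}"

text \<open>The span of the monomials is so far only known to be stable under left multiplication by
  \<open>x\<close> and \<open>y\<close>. Its left multipliers form a subalgebra all the
  same.\<close>

lemma weyl_subalgebra_left_stabilizer:
  "weyl.subspace B \<Longrightarrow> weyl_subalgebra (left_stabilizer B)"
  by (auto simp: weyl_subalgebra_def left_stabilizer_def weyl.subspace_def distrib_right
      weyl_scale_mult_left mult.assoc)

lemma X_poly_in_subalgebra:
  "weyl_subalgebra L \<Longrightarrow> weyl_X \<in> L \<Longrightarrow> X_poly p \<in> L"
  by (induction p) (auto simp: weyl_subalgebra_def weyl.subspace_def)

text \<open>Here \<open>u\<close> is a polynomial \<open>p\<close> in \<open>weyl_X\<close> and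
  \<open>v\<close> is \<open>r + q weyl_Y\<close>, with commutator \<open>q p'\<close>. A nonzero
  constant value forces \<open>q\<close> to be constant and \<open>p\<close> linear, so
  \<open>weyl_X\<close> and then \<open>weyl_Y\<close> can be solved for.\<close>

lemma order_1_generators:
  fixes u v :: "'k::field_char_0 weyl"
  assumes L: "weyl_subalgebra L" "u \<in> L" "v \<in> L"
    and "u \<in> below 1" "v \<in> below 2" "commutator v u = c *\<^sub>W 1" "c \<noteq> 0"
  shows "weyl_X \<in> L \<and> weyl_Y \<in> L"
proof -
  have closed: "a + b \<in> L" "a - b \<in> L" "k *\<^sub>W a \<in> L" "1 \<in> L" if "a \<in> L" "b \<in> L" for a b k
    using L(1) that weyl.subspace_diff by (auto simp: weyl_subalgebra_def weyl.subspace_def)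
  obtain p where p: "u = X_poly p"
    using assms(4) below_Suc_cases[of u 0] by (auto simp: numeral_eq_Suc)
  have "v \<in> below (Suc (Suc 0))" using assms(5) by (simp add: numeral_2_eq_2)
  then obtain r v' where v': "v = X_poly r + v' * weyl_Y" "v' \<in> below (Suc 0)"
    by (rule below_Suc_cases)
  then obtain q where q: "v' = X_poly q"
    by (auto elim: below_Suc_cases)
  have "X_poly [:c:] = commutator v u"
    by (simp add: assms(6))
  also have "\<dots> = X_poly (q * pderiv p)"
    by (simp add: v'(1) q p commutator_simps commutator_Y_X_poly X_poly_mult)
  finally have qp: "q * pderiv p = [:c:]"
    by (metis cf_simps(9))
  then have "q dvd [:c:]" "pderiv p dvd [:c:]" by (metis dvd_triv_left, metis dvd_triv_right)
  moreover have "degree q + degree (pderiv p) = 0"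
    using qp assms(7) by (metis degree_mult_eq degree_pCons_0 mult_eq_0_iff pCons_eq_0_iff)
  ultimately obtain q0 where q0: "q = [:q0:]" "degree (pderiv p) = 0"
    by (metis add_is_0 degree_eq_zeroE)
  then have "degree p \<le> 1" by (simp add: degree_pderiv)
  then have "p = [:coeff p 0, coeff p 1:]"
    by (intro poly_eqI) (auto simp: coeff_pCons coeff_eq_0 split: nat.splits)
  then obtain p0 p1 where p01: "p = [:p0, p1:]" by blast
  have c: "q0 * p1 = c"
    using qp by (simp add: q0 p01 pderiv_pCons mult.commute)
  with assms(7) have nz: "q0 \<noteq> 0" "p1 \<noteq> 0" by auto
  have "weyl_X = (1 / p1) *\<^sub>W (u - p0 *\<^sub>W 1)"
    using nz by (simp add: p p01 weyl_scale_mult_right)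
  then have X: "weyl_X \<in> L" using closed L(2) by metis
  have "weyl_Y = (1 / q0) *\<^sub>W (v - X_poly r)"
    using nz by (simp add: v'(1) q q0 weyl_scale_mult_left)
  then have "weyl_Y \<in> L" using closed L(3) X_poly_in_subalgebra[OF L(1) X] by metis
  with X show ?thesis by simp
qed

context weyl_pair
begin

text \<open>One of \<open>x\<close> and \<open>y\<close> has order 0 and the other order at most 1.
  The left multipliers of the span therefore contain both generators and hence everything; applied
  to 1 they show that monomials span the whole algebra.\<close>

lemma eig_mspan_small:
  assumes "ord H \<le> 1" "u \<in> eig H c"
  shows "u \<in> mspan c"
proof -
  let ?B = "weyl.span (range (case_prod mon))"
  let ?L = "left_stabilizer ?B"
  have L: "weyl_subalgebra ?L"
    by (simp add: weyl_subalgebra_left_stabilizer)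
  have xy_L: "x \<in> ?L" "y \<in> ?L"
    by (simp_all add: left_stabilizer_def mon_mult_left_closed)
  have "weyl_X \<in> ?L \<and> weyl_Y \<in> ?L"
  proof (cases "ord x = 0")
    case True
    then have "x \<in> below 1" "y \<in> below 2"
      using assms(1) by (simp_all add: ord_H below_iff_ord)
    then show ?thesis
      using order_1_generators[OF L, of x y 1] xy_L comm by simp
  next
    case False
    then have "y \<in> below 1" "x \<in> below 2"
      using assms(1) by (simp_all add: ord_H below_iff_ord)
    moreover have "commutator x y = (- 1) *\<^sub>W 1"
      by (simp add: commutator_swap[of x y] comm weyl.scale_minus_left)
    ultimately show ?thesis
      using order_1_generators[OF L, of y x "- 1"] xy_L by simp
  qed
  then have XY_L: "weyl_X \<in> ?L" "weyl_Y \<in> ?L" by auto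
  have "v \<in> ?L" for v
    by (induction v rule: weyl_left_induct)
      (use L XY_L in \<open>auto simp: weyl_subalgebra_def weyl.subspace_def\<close>)
  then have "u \<in> ?L" .
  moreover have "1 \<in> ?B"
    by (rule weyl.span_base, rule image_eqI[of _ _ "(0, 0)"]) (simp_all add: mon_def)
  ultimately have "u \<in> ?B"
    by (force simp: left_stabilizer_def)
  with assms(2) show ?thesis by (rule eig_span_mon)
qed

end

section \<open>Vanishing Wronskians and commutators with powers\<close>

lemma wronskian_degree:
  fixes f g :: "'k::field_char_0 poly"
  assumes "pderiv f * g = f * pderiv g" "f \<noteq> 0" "g \<noteq> 0"
  shows "degree f = degree g"
proof (cases "degree f = 0 \<or> degree g = 0")
  case True
  then show ?thesis
    using assms by (auto simp: pderiv_eq_0_iff[symmetric] simp del: pderiv_eq_0_iff) (auto simp: pderiv_eq_0_iff)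
next
  case False
  then have "pderiv f \<noteq> 0" "pderiv g \<noteq> 0" by (auto simp: pderiv_eq_0_iff)
  \<comment> \<open>The leading coefficients of the two sides differ only in the factors
    \<open>degree f\<close> and \<open>degree g\<close>, which characteristic zero
    distinguishes.\<close>
  have "of_nat (degree f) * (lead_coeff f * lead_coeff g) = lead_coeff (pderiv f * g)"
    using False by (simp add: lead_coeff_mult coeff_pderiv degree_pderiv)
  also have "\<dots> = of_nat (degree g) * (lead_coeff f * lead_coeff g)"
    unfolding assms(1) using False by (simp add: lead_coeff_mult coeff_pderiv degree_pderiv)
  finally show ?thesis using assms(2,3) by simp
qed

text \<open>Subtract the multiple of \<open>g\<close> that removes the leading term of
  \<open>f\<close>. The difference still has vanishing Wronskian with \<open>g\<close>, so if
  nonzero it would again have the degree of \<open>g\<close>.\<close>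

lemma wronskian_proportional:
  fixes f g :: "'k::field_char_0 poly"
  assumes W: "pderiv f * g = f * pderiv g" and "g \<noteq> 0"
  obtains k where "f = smult k g"
proof (rule ccontr)
  assume no: "\<not> thesis"
  define h where "h = f - smult (lead_coeff f / lead_coeff g) g"
  have "f \<noteq> 0" using no that[of 0] by auto
  then have deg: "degree f = degree g"
    using wronskian_degree[OF W] assms(2) by simp
  have "h \<noteq> 0" using no that by (auto simp: h_def)
  moreover have "pderiv h * g = h * pderiv g"
    using W by (simp add: h_def pderiv_diff pderiv_smult algebra_simps)
  ultimately have "degree h = degree g"
    using wronskian_degree assms(2) by blast
  moreover have "coeff h (degree g) = 0"
    using assms(2) deg by (simp add: h_def)
  ultimately show False using \<open>h \<noteq> 0\<close> by (metis leading_coeff_0_iff)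
qed

lemma below_cancel_right:
  assumes "a * v \<in> below (p + ord v)" "v \<noteq> 0"
  shows "a \<in> below p"
  using assms by (cases "a = 0") (auto simp: below_iff_ord ord_mult)

lemma lc_power: "lc (u ^ k) = lc u ^ k"
proof (induction k)
  case 0
  show ?case using cf_simps(9)[of 1] by (simp del: cf_simps)
qed (simp add: lc_mult)

text \<open>By the Leibniz rule the commutator is a sum of \<open>Suc k\<close> terms with the same
  leading coefficient. In characteristic zero these cannot cancel.\<close>

lemma ord_commutator_power:
  assumes "commutator a u \<noteq> 0"
  shows "commutator a (u ^ Suc k) \<noteq> 0 \<and> ord (commutator a (u ^ Suc k)) = ord (commutator a u) + k * ord u"
proof -
  let ?z = "commutator a u"
  have u: "u \<noteq> 0" using assms by (auto simp: commutator_simps)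
  have "commutator a (u ^ Suc k) \<in> below (Suc (ord ?z + k * ord u)) \<and>
    cf (commutator a (u ^ Suc k)) (ord ?z + k * ord u) = of_nat (Suc k) * (lc ?z * lc u ^ k)"
  proof (induction k)
    case 0
    show ?case by (simp add: below_Suc_ord)
  next
    case (Suc k)
    let ?w = "commutator a (u ^ Suc k)"
    have eq: "commutator a (u ^ Suc (Suc k)) = ?z * u ^ Suc k + u * ?w"
      by (simp only: power_Suc[of u "Suc k"] commutator_simps(4))
    have 1: "?z * u ^ Suc k \<in> below (Suc (ord ?z + Suc k * ord u))"
      "cf (?z * u ^ Suc k) (ord ?z + Suc k * ord u) = lc ?z * lc u ^ Suc k"
      using below_mult[OF below_Suc_ord below_Suc_ord, of ?z "u ^ Suc k"]
        cf_mult[OF below_Suc_ord below_Suc_ord, of ?z "u ^ Suc k"] lc_power[of u "Suc k"]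
      by (simp_all only: ord_power[OF u])
    have 2: "u * ?w \<in> below (Suc (ord u + (ord ?z + k * ord u)))"
      "cf (u * ?w) (ord u + (ord ?z + k * ord u)) = lc u * (of_nat (Suc k) * (lc ?z * lc u ^ k))"
      using below_mult[OF below_Suc_ord, of ?w _ u] cf_mult[OF below_Suc_ord, of ?w _ u] Suc
      by auto
    have idx: "ord u + (ord ?z + k * ord u) = ord ?z + Suc k * ord u" by simp
    show ?case
      unfolding eq using 1 2 unfolding idx
      by (auto intro!: below_intros simp: algebra_simps)
  qed
  then show ?thesis
    using assms u by (auto intro: ord_eqI simp del: power_Suc of_nat_Suc)
qed

section \<open>The asymptotic exponent of an eigenvector\<close>

locale weyl_pair_high = weyl_pair x y for x y :: "'k::field_char_0 weyl" +
  assumes ord_H_ge: "ord H \<ge> 2"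
begin

text \<open>The commutator with \<open>H\<close> is a multiple of \<open>u\<close>. Since
  \<open>ord H \<ge> 2\<close>, degree \<open>ord H + ord u - 1\<close> exceeds
  \<open>ord u\<close>, so the Poisson bracket of the leading symbols vanishes.\<close>

lemma eig_lc:
  assumes "u \<in> eig H c" "u \<noteq> 0"
  shows "of_nat (ord H) * lc H * pderiv (lc u) = of_nat (ord u) * lc u * pderiv (lc H)"
proof -
  define k where "k = ord H + ord u - 1"
  have k: "Suc k = ord H + ord u" "ord u < k" using ord_H_ge by (auto simp: k_def)
  have "cf (commutator H u) k = 0"
    using assms(1) below_Suc_ord[of u] k(2) by (simp add: eig_iff below_iff)
  then show ?thesis
    using cf_commutator[OF below_Suc_ord below_Suc_ord k(1)] by simp
qed

text \<open>At equal order, both leading coefficients solve the differential equation of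
  \<open>eig_lc\<close>, in which the eigenvalue does not occur. Their Wronskian is therefore zero,
  even when \<open>c\<close> and \<open>d\<close> differ.\<close>

lemma eig_proportional:
  assumes "u \<in> eig H c" "u \<in> below (Suc (ord v))" "v \<in> eig H d" "v \<noteq> 0"
  obtains k where "u - k *\<^sub>W v \<in> below (ord v)"
proof (cases "u \<in> below (ord v)")
  case True
  then show thesis using that[of 0] by simp
next
  case False
  then have u: "u \<noteq> 0" "ord u = ord v" using assms(2) by (auto simp: below_iff_ord)
  define n where "n = (of_nat (ord H) :: 'k poly)"
  have n: "n \<noteq> 0" using ord_H_ge by (simp add: n_def)
  have "n * lc H * (pderiv (lc u) * lc v) = n * lc H * (lc u * pderiv (lc v))"
  proof -
    have "n * lc H * (pderiv (lc u) * lc v) = (n * lc H * pderiv (lc u)) * lc v"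
      by (simp only: mult.assoc)
    also have "\<dots> = lc u * (of_nat (ord v) * lc v * pderiv (lc H))"
      unfolding n_def eig_lc[OF assms(1) u(1)] by (simp only: mult_ac u(2))
    also have "\<dots> = n * lc H * (lc u * pderiv (lc v))"
      unfolding n_def eig_lc[OF assms(3,4), symmetric] by (simp only: mult_ac)
    finally show ?thesis .
  qed
  then have "pderiv (lc u) * lc v = lc u * pderiv (lc v)"
    using n by (simp only: mult_cancel_left mult_eq_0_iff lc_eq_0_iff nonzero simp_thms)
  then obtain k where "lc u = smult k (lc v)"
    using assms(4) by (auto elim: wronskian_proportional)
  then have "u - k *\<^sub>W v \<in> below (ord v)"
    using below_Suc_ord[of u] below_Suc_ord[of v] u(2)
    by (auto simp: below_iff) (metis Suc_le_eq le_neq_implies_less weyl.scale_zero_right smult_0_right)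
  then show thesis by (rule that)
qed

lemma eig_ord_0:
  assumes "u \<in> eig H c" "ord u = 0"
  obtains k where "u = k *\<^sub>W 1"
proof -
  have "u \<in> below (Suc (ord 1))" using assms(2) below_Suc_ord[of u] by simp
  then obtain k where "u - k *\<^sub>W 1 \<in> below (ord 1)"
    using eig_proportional[OF assms(1) _ eig_intros(2)] by auto
  then show thesis using that[of k] by simp
qed

text \<open>An eigenvector of order 0 is a scalar and commutes with everything. Positivity later
  ensures that splitting off a factor \<open>x\<close> or \<open>y\<close> lowers the order.\<close>

lemma ord_pos: "0 < ord x" "0 < ord y"
proof -
  show "0 < ord x"
  proof (rule ccontr)
    assume "\<not> 0 < ord x"
    then obtain k where "x = k *\<^sub>W 1" using eig_ord_0[OF eig_x] by auto
    then show False using comm by (simp add: commutator_simps)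
  qed
  show "0 < ord y"
  proof (rule ccontr)
    assume "\<not> 0 < ord y"
    then obtain k where "y = k *\<^sub>W 1" using eig_ord_0[OF eig_y] by auto
    then show False using comm by (simp add: commutator_simps)
  qed
qed

text \<open>Heuristically, \<open>wt u e\<close> means that \<open>u\<close> behaves like \<open>x\<^sup>c H\<^sup>e\<close> at infinity.\<close>

definition wt :: "'k weyl \<Rightarrow> 'k \<Rightarrow> bool"
  where "wt u e \<longleftrightarrow> u \<noteq> 0 \<and> \<delta> u + e *\<^sub>W u \<in> below (ord u)"

lemma wt_below: "wt u e \<Longrightarrow> \<delta> u \<in> below (Suc (ord u))"
proof -
  assume "wt u e"
  then have "\<delta> u + e *\<^sub>W u \<in> below (Suc (ord u))"
    by (auto simp: wt_def elim: below_mono)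
  then have "(\<delta> u + e *\<^sub>W u) - e *\<^sub>W u \<in> below (Suc (ord u))"
    by (rule below_intros(3)) (intro below_intros(5) below_Suc_ord)
  then show ?thesis by simp
qed

lemma wt_unique:
  assumes "wt u e" "wt u f"
  shows "e = f"
proof -
  have "(\<delta> u + e *\<^sub>W u) - (\<delta> u + f *\<^sub>W u) \<in> below (ord u)"
    using assms unfolding wt_def by (intro below_intros(3)) auto
  then have "(e - f) *\<^sub>W u \<in> below (ord u)"
    by (simp add: weyl.scale_left_diff_distrib)
  then have "cf ((e - f) *\<^sub>W u) (ord u) = 0" by (simp only: below_iff order.refl)
  then have "smult (e - f) (lc u) = 0" by (simp only: cf_simps)
  then show ?thesis using assms(1) by (simp add: wt_def)
qed

lemma one_below: "(1 :: 'k weyl) \<in> below (ord H)"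
  using ord_H_ge by (simp add: below_iff_ord)

section \<open>Exponents of products, factors and roots\<close>

lemma wt_1: "wt 1 0" and wt_x: "wt x 0" and wt_y: "wt y 1" and wt_H: "wt H 1"
proof -
  show "wt 1 0" "wt x 0" "wt y 1"
    by (auto simp: wt_def \<delta>_def commutator_simps commutator_swap[of x y] comm below_intros)
  have "\<delta> H = - (x * y)"
    by (simp add: \<delta>_def commutator_simps commutator_swap[of x y] comm H_def)
  then show "wt H 1" using one_below by (simp add: wt_def xy)
qed

text \<open>This is the cross term by which \<open>\<delta>\<close> fails to be a derivation, see
  \<open>\<delta>_mult\<close>. The commutator with \<open>y\<close> loses one order, which makes
  the term negligible in \<open>wt_mult\<close> and \<open>wt_cancel\<close>.\<close>

lemma below_commutator_mult:
  assumes "\<delta> u \<in> below (Suc (ord u))"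
  shows "commutator x u * commutator v y \<in> below (ord u + ord v)"
proof (cases "commutator x u = 0")
  case False
  with assms have le: "ord (commutator x u) + ord y \<le> ord u"
    by (simp add: \<delta>_def below_iff_ord ord_mult)
  show ?thesis
    by (rule below_mult'[OF below_Suc_ord below_commutator[OF below_Suc_ord below_Suc_ord]])
      (use le in simp)
qed (simp add: below_intros)

lemma \<delta>_mult: "\<delta> (u * v) = \<delta> u * v + commutator x u * commutator v y + u * \<delta> v"
  by (simp add: \<delta>_def commutator_def algebra_simps)

lemma below_mult_less: "a \<in> below (ord u) \<Longrightarrow> a * v \<in> below (ord u + ord v)"
  "b \<in> below (ord v) \<Longrightarrow> u * b \<in> below (ord u + ord v)"
  using below_mult'[OF _ below_Suc_ord] below_mult'[OF below_Suc_ord] by fastforce+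

lemma wt_mult:
  assumes "wt u e" "wt v f"
  shows "wt (u * v) (e + f)"
proof -
  have "\<delta> (u * v) + (e + f) *\<^sub>W (u * v)
      = (\<delta> u + e *\<^sub>W u) * v + commutator x u * commutator v y + u * (\<delta> v + f *\<^sub>W v)"
    by (simp add: \<delta>_mult distrib_left distrib_right weyl_scale_mult_left weyl_scale_mult_right
        weyl.scale_left_distrib)
  also have "\<dots> \<in> below (ord u + ord v)"
    using assms by (intro below_intros(2)[OF below_intros(2)] below_mult_less below_commutator_mult
        wt_below[OF assms(1)])
      (auto simp: wt_def)
  finally show ?thesis using assms by (simp add: wt_def ord_mult)
qed

lemma wt_power: "wt u e \<Longrightarrow> wt (u ^ k) (of_nat k * e)"
proof (induction k)
  case (Suc k)
  then show ?case using wt_mult[of u e "u ^ k" "of_nat k * e"] by (simp add: algebra_simps)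
qed (simp add: wt_1)

text \<open>The bound on \<open>\<delta> u\<close> is first recovered by expressing
  \<open>[x, u] v y\<close> as \<open>\<delta> (u v) - u \<delta> v\<close>. Then the product
  formula is read backwards and \<open>v\<close> is cancelled.\<close>

lemma wt_cancel:
  assumes "wt (u * v) g" "wt v f"
  shows "wt u (g - f)"
proof -
  have nz: "u \<noteq> 0" "v \<noteq> 0" using assms by (auto simp: wt_def)
  have "commutator x u * v * y = \<delta> (u * v) - u * \<delta> v"
    by (simp add: \<delta>_def commutator_simps algebra_simps)
  also have "\<dots> \<in> below (Suc (ord u + ord v))"
    using wt_below[OF assms(1)] below_mult[OF below_Suc_ord wt_below[OF assms(2)]] nz
    by (intro below_intros) (simp_all add: ord_mult)
  finally have "commutator x u = 0 \<or> ord (commutator x u) + ord y \<le> ord u"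
    using nz by (cases "commutator x u = 0") (simp_all add: below_iff_ord ord_mult)
  then have \<delta>u: "\<delta> u \<in> below (Suc (ord u))"
    by (cases "commutator x u = 0") (simp_all add: \<delta>_def below_iff_ord ord_mult)
  have "(\<delta> u + (g - f) *\<^sub>W u) * v
      = (\<delta> (u * v) + g *\<^sub>W (u * v)) - commutator x u * commutator v y - u * (\<delta> v + f *\<^sub>W v)"
    by (simp add: \<delta>_mult distrib_left distrib_right left_diff_distrib weyl_scale_mult_left
        weyl_scale_mult_right weyl.scale_left_diff_distrib)
  also have "\<dots> \<in> below (ord u + ord v)"
  proof (rule below_intros(3)[OF below_intros(3)])
    show "\<delta> (u * v) + g *\<^sub>W (u * v) \<in> below (ord u + ord v)"
      using assms(1) nz by (simp add: wt_def ord_mult)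
    show "u * (\<delta> v + f *\<^sub>W v) \<in> below (ord u + ord v)"
      using assms(2) by (intro below_mult_less) (simp add: wt_def)
  qed (rule below_commutator_mult[OF \<delta>u])
  finally show ?thesis
    using nz by (auto simp: wt_def intro: below_cancel_right)
qed

text \<open>Since \<open>\<delta> u\<close> is an eigenvector with the same eigenvalue, an order not
  above that of \<open>u\<close> makes its leading term proportional to that of
  \<open>u\<close>.\<close>

lemma eig_wt:
  assumes "u \<in> eig H c" "u \<noteq> 0" "\<delta> u \<in> below (Suc (ord u))"
  obtains e where "wt u e"
proof -
  obtain k where "\<delta> u - k *\<^sub>W u \<in> below (ord u)"
    using eig_proportional[OF eig_\<delta>[OF assms(1)] assms(3,1,2)] .
  then show thesis using assms(2) that[of "- k"] by (simp add: wt_def weyl.scale_minus_left)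
qed

lemma ord_\<delta>: "\<delta> u \<noteq> 0 \<Longrightarrow> ord (\<delta> u) = ord (commutator x u) + ord y"
  by (auto simp: \<delta>_def ord_mult)

text \<open>An excess of the order of \<open>\<delta> u\<close> over that of \<open>u\<close> would
  persist in \<open>u ^ q\<close> by \<open>ord_commutator_power\<close>. So \<open>u\<close> has an
  exponent, and uniqueness for \<open>u ^ q\<close> determines it.\<close>

lemma wt_root:
  assumes "u \<in> eig H c" "wt (u ^ q) g" "q > 0"
  shows "wt u (g / of_nat q)"
proof -
  obtain k where q: "q = Suc k" using assms(3) by (cases q) auto
  have u: "u \<noteq> 0" using assms(2,3) by (auto simp: wt_def power_0_left)
  have "\<delta> u \<in> below (Suc (ord u))"
  proof (cases "commutator x u = 0")
    case False
    have "\<delta> (u ^ q) \<in> below (Suc (q * ord u))"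
      using wt_below[OF assms(2)] u by (simp add: ord_power)
    moreover have "\<delta> (u ^ q) \<noteq> 0" "ord (\<delta> (u ^ q)) = ord (commutator x u) + k * ord u + ord y"
      using ord_commutator_power[OF False, of k] by (simp_all add: \<delta>_def q ord_mult del: power_Suc)
    ultimately show ?thesis
      using False by (simp add: \<delta>_def below_iff_ord ord_mult q)
  qed (simp add: \<delta>_def below_intros)
  then obtain e where e: "wt u e" using eig_wt assms(1) u by blast
  have "of_nat q * e = g"
    using wt_unique[OF wt_power[OF e] assms(2)] .
  then show ?thesis using e assms(3) by (auto simp: field_simps)
qed

text \<open>Take a counterexample with the largest excess \<open>f u\<close>, which exists because
  the excess is at most \<open>ord H\<close>. Subtracting a multiple of \<open>H ^ d\<close> from
  \<open>u ^ n\<close> lowers the order, but the higher order of \<open>\<delta> (u ^ n)\<close>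
  survives, so the difference has larger excess.\<close>

lemma \<delta>_below_eig_0:
  assumes "u \<in> eig H 0"
  shows "\<delta> u \<in> below (Suc (ord u))"
proof (rule ccontr)
  define P where "P = (\<lambda>u. u \<in> eig H 0 \<and> \<delta> u \<notin> below (Suc (ord u)))"
  \<comment> \<open>Where \<open>P\<close> holds the difference is positive, so truncated
    subtraction loses nothing.\<close>
  define f where "f = (\<lambda>u. ord (\<delta> u) - ord u)"
  assume "\<delta> u \<notin> below (Suc (ord u))"
  then have "P u" using assms by (simp add: P_def)
  moreover have "\<forall>v. P v \<longrightarrow> f v \<le> ord H"
  proof (intro allI impI)
    fix v assume "P v"
    then have v: "v \<noteq> 0" "\<delta> v \<noteq> 0" by (auto simp: P_def \<delta>_simps below_intros)
    then have "commutator x v \<noteq> 0" by (auto simp: \<delta>_def)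
    then have "ord (commutator x v) < ord x + ord v"
      using below_commutator[OF below_Suc_ord below_Suc_ord, of x v] by (simp add: below_iff_ord)
    then show "f v \<le> ord H" using v by (simp add: f_def ord_\<delta> ord_H)
  qed
  ultimately obtain u where u: "P u" and max: "\<And>v. P v \<Longrightarrow> f v \<le> f u"
    using ex_has_greatest_nat[of P u f "Suc (ord H)"] by (auto simp: less_Suc_eq_le)
  define n d where "n = ord H" and "d = ord u"
  obtain m where m: "n = Suc m" using ord_H_ge by (cases n) (auto simp: n_def)
  have u0: "u \<in> eig H 0" "u \<noteq> 0" "\<delta> u \<noteq> 0" "ord (\<delta> u) > d"
    using u by (auto simp: P_def d_def \<delta>_simps below_iff_ord)
  define T where "T = ord (\<delta> u) + m * d"
  have T: "n * d < T" using u0 by (simp add: T_def m)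
  have "commutator x u \<noteq> 0" using u0(3) by (auto simp: \<delta>_def)
  from ord_commutator_power[OF this, of m]
  have ord_un: "\<delta> (u ^ n) \<noteq> 0" "ord (\<delta> (u ^ n)) = T"
    using u0 by (simp_all add: T_def ord_\<delta> d_def m) (auto simp: \<delta>_def ord_mult)
  have eigs: "u ^ n \<in> eig H 0" "H ^ d \<in> eig H 0"
    using eig_power[OF u0(1), of n] eig_power[OF eig_self[of H], of d] by simp_all
  have ords: "ord (u ^ n) = n * d" "ord (H ^ d) = n * d"
    using u0 by (simp_all add: ord_power d_def n_def mult.commute)
  obtain k where k: "u ^ n - k *\<^sub>W H ^ d \<in> below (n * d)"
    using eig_proportional[OF eigs(1) _ eigs(2)] below_Suc_ord[of "u ^ n"] ords by auto
  define w where "w = u ^ n - k *\<^sub>W H ^ d"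
  have w: "w \<in> eig H 0" unfolding w_def using eigs by (intro eig_intros)
  have "\<delta> (H ^ d) \<in> below (Suc (n * d))"
    using wt_below[OF wt_power[OF wt_H, of d]] ords by simp
  then have "\<delta> (H ^ d) \<in> below T" using T by (auto elim: below_mono)
  then have "cf (\<delta> w) T = cf (\<delta> (u ^ n)) T" "\<delta> w \<in> below (Suc T)"
    using below_Suc_ord[of "\<delta> (u ^ n)"] ord_un unfolding w_def \<delta>_simps
    by (auto simp: below_iff)
  then have ord_w: "ord (\<delta> w) = T"
    using ord_un by (intro ord_eqI) auto
  have "\<delta> w \<noteq> 0" using ord_w T by (auto simp: ord_def)
  then have "w \<noteq> 0" by (auto simp: \<delta>_simps)
  with k have "ord w < n * d" by (simp add: w_def below_iff_ord)
  then have "P w" "f w > f u"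
    using w ord_w T \<open>\<delta> w \<noteq> 0\<close> u0(4) by (auto simp: P_def f_def below_iff_ord T_def m d_def)
  with max show False by (meson not_le)
qed

text \<open>The elements \<open>u ^ n\<close> and \<open>H ^ d\<close> have the same order and, up
  to a scalar, the same leading term. Their difference \<open>w\<close> has lower order, and so has
  \<open>\<delta> w\<close>, which forces the exponents \<open>n e\<close> and \<open>d\<close> to
  agree.\<close>

lemma wt_eig_0:
  assumes "u \<in> eig H 0" "u \<noteq> 0"
  shows "wt u (of_nat (ord u) / of_nat (ord H))"
proof -
  define n d where "n = ord H" and "d = ord u"
  have n: "n > 0" using ord_H_ge by (simp add: n_def)
  obtain e where e: "wt u e"
    using eig_wt[OF assms \<delta>_below_eig_0[OF assms(1)]] .
  have eigs: "u ^ n \<in> eig H 0" "H ^ d \<in> eig H 0"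
    using eig_power[OF assms(1), of n] eig_power[OF eig_self[of H], of d] by simp_all
  have ords: "ord (u ^ n) = n * d" "ord (H ^ d) = n * d"
    using assms by (simp_all add: ord_power d_def n_def mult.commute)
  obtain k where k: "u ^ n - k *\<^sub>W H ^ d \<in> below (n * d)"
    using eig_proportional[OF eigs(1) _ eigs(2)] below_Suc_ord[of "u ^ n"] ords by auto
  define w where "w = u ^ n - k *\<^sub>W H ^ d"
  have w: "w \<in> eig H 0" unfolding w_def using eigs by (intro eig_intros)
  have \<delta>w: "\<delta> w \<in> below (n * d)"
    using \<delta>_below_eig_0[OF w] k[folded w_def] by (cases "w = 0") (auto simp: \<delta>_simps below_iff_ord)
  have 1: "\<delta> (u ^ n) + (of_nat n * e) *\<^sub>W u ^ n \<in> below (n * d)"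
    using wt_power[OF e, of n] ords by (simp add: wt_def)
  have 2: "\<delta> (H ^ d) + of_nat d *\<^sub>W H ^ d \<in> below (n * d)"
    using wt_power[OF wt_H, of d] ords by (simp add: wt_def)
  have "(of_nat n * e - of_nat d) *\<^sub>W u ^ n
      = (\<delta> (u ^ n) + (of_nat n * e) *\<^sub>W u ^ n) - k *\<^sub>W (\<delta> (H ^ d) + of_nat d *\<^sub>W H ^ d)
        - \<delta> w - of_nat d *\<^sub>W w"
    by (simp add: w_def \<delta>_simps weyl.scale_left_diff_distrib weyl.scale_right_diff_distrib
        weyl.scale_right_distrib weyl.scale_left_commute[of k])
  also have "\<dots> \<in> below (n * d)"
    using k[folded w_def] by (intro below_intros(3,5) 1 2 \<delta>w)
  finally have "smult (of_nat n * e - of_nat d) (lc (u ^ n)) = 0"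
    using ords by (simp add: below_iff)
  then have "of_nat n * e = of_nat d" using assms(2) by simp
  then have "e = of_nat d / of_nat n" using n by (simp add: field_simps)
  with e show ?thesis by (simp add: n_def d_def)
qed

text \<open>The relation \<open>q c + m = p\<close> puts \<open>u ^ q * x ^ m * y ^ p\<close> into
  the centralizer of \<open>H\<close>, where exponents are known. The powers of \<open>y\<close> and
  \<open>x\<close> are then cancelled and a root is taken.\<close>

lemma wt_eig:
  assumes "u \<in> eig H c" "u \<noteq> 0"
  shows "wt u ((of_nat (ord u) - c * of_nat (ord x)) / of_nat (ord H))"
proof -
  obtain q m p where q: "q > 0" and c: "of_nat q * c + of_nat m - of_nat p = 0"
    using eigenvalue_rational[OF assms] .
  define n :: 'k where "n = of_nat (ord H)"
  have n: "n \<noteq> 0" using ord_H_ge by (simp add: n_def)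
  have nxy: "n = of_nat (ord x) + of_nat (ord y)" by (simp add: n_def ord_H)
  let ?v = "u ^ q * x ^ m * y ^ p"
  have "?v \<in> eig H (of_nat q * c + of_nat m * 1 + of_nat p * (- 1))"
    by (intro eig_mult eig_power assms eig_x eig_y)
  then have "?v \<in> eig H 0" using c by simp
  moreover have "?v \<noteq> 0" using assms(2) by simp
  ultimately have "wt ?v (of_nat (ord ?v) / n)"
    unfolding n_def by (rule wt_eig_0)
  from wt_cancel[OF this wt_power[OF wt_y]]
  have "wt (u ^ q * x ^ m) (of_nat (ord ?v) / n - of_nat p)" by simp
  from wt_cancel[OF this wt_power[OF wt_x]]
  have "wt (u ^ q) (of_nat (ord ?v) / n - of_nat p)" by simp
  from wt_root[OF assms(1) this q]
  have "wt u ((of_nat (ord ?v) / n - of_nat p) / of_nat q)" .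
  also have "(of_nat (ord ?v) / n - of_nat p) / of_nat q
      = (of_nat (ord u) - c * of_nat (ord x)) / n"
  proof -
    have ord_v: "of_nat (ord ?v) = of_nat q * of_nat (ord u) + of_nat m * of_nat (ord x) + of_nat p * (of_nat (ord y) :: 'k)"
      using assms(2) by (simp add: ord_mult ord_power)
    have p: "of_nat p = of_nat q * c + (of_nat m :: 'k)" using c by simp
    have "of_nat (ord ?v) - of_nat p * n = of_nat q * (of_nat (ord u) - c * of_nat (ord x))"
      unfolding ord_v nxy p by (simp add: algebra_simps)
    then have "of_nat (ord ?v) / n - of_nat p = of_nat q * (of_nat (ord u) - c * of_nat (ord x)) / n"
      using n by (metis diff_divide_distrib nonzero_mult_div_cancel_right)
    then show ?thesis using q by simp
  qed
  finally show ?thesis by (simp add: n_def)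
qed

end

section \<open>Eigenvectors as combinations of monomials\<close>

context weyl_pair_high
begin

text \<open>The order bound is imposed on every monomial and not merely on the sum, so closure
  properties can be checked monomial by monomial.\<close>

definition mspan_below :: "'k \<Rightarrow> nat \<Rightarrow> 'k weyl set"
  where "mspan_below c d = weyl.span {mon a b | a b. of_nat a - of_nat b = c \<and> ord (mon a b) < d}"

lemma mspan_below_intros:
  "0 \<in> mspan_below c d"
  "u \<in> mspan_below c d \<Longrightarrow> v \<in> mspan_below c d \<Longrightarrow> u + v \<in> mspan_below c d"
  "u \<in> mspan_below c d \<Longrightarrow> v \<in> mspan_below c d \<Longrightarrow> u - v \<in> mspan_below c d"
  "u \<in> mspan_below c d \<Longrightarrow> k *\<^sub>W u \<in> mspan_below c d"
  by (simp_all add: mspan_below_def weyl.span_zero weyl.span_add weyl.span_diff weyl.span_scale)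

lemma mon_in_mspan_below: "of_nat a - of_nat b = c \<Longrightarrow> ord (mon a b) < d \<Longrightarrow> mon a b \<in> mspan_below c d"
  unfolding mspan_below_def by (intro weyl.span_base) auto


lemma mspan_below_induct:
  assumes "u \<in> mspan_below c d" "weyl.subspace S"
    and "\<And>a b. of_nat a - of_nat b = c \<Longrightarrow> ord (mon a b) < d \<Longrightarrow> mon a b \<in> S"
  shows "u \<in> S"
  using assms(1) unfolding mspan_below_def
  by (rule subsetD[OF weyl.span_minimal, rotated 2]) (use assms(2,3) in auto)

lemma mspan_below_mono: "u \<in> mspan_below c d \<Longrightarrow> d \<le> d' \<Longrightarrow> u \<in> mspan_below c d'"
  by (erule mspan_below_induct[of u c d "mspan_below c d'"])
    (auto simp: weyl.subspace_def intro: mspan_below_intros mon_in_mspan_below)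

lemma mspan_below_subset: "u \<in> mspan_below c d \<Longrightarrow> u \<in> eig H c \<and> u \<in> below d"
  by (rule mspan_below_induct[of u c d "eig H c \<inter> below d", unfolded Int_iff])
    (auto simp: weyl.subspace_def below_iff_ord[of "mon _ _"] intro: eig_intros below_intros eig_mon)

lemma mspan_below_H_mult:
  "u \<in> mspan_below c d \<Longrightarrow> H * u \<in> mspan_below c (d + ord H)"
  by (rule mspan_below_induct[of u c d "{u. H * u \<in> mspan_below c (d + ord H)}", unfolded mem_Collect_eq])
    (auto simp: weyl.subspace_def distrib_left weyl_scale_mult_right H_mon ord_mon ord_H
      intro!: mspan_below_intros mon_in_mspan_below)

lemma mspan_below_mult_x:
  assumes "u \<in> mspan_below (c - 1) d"
  shows "u * x \<in> mspan_below c (d + ord x)"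
proof (rule mspan_below_induct[OF assms, of "{u. u * x \<in> mspan_below c (d + ord x)}", unfolded mem_Collect_eq])
  fix a b assume ab: "of_nat a - of_nat b = c - 1" "ord (mon a b) < d"
  show "mon a b * x \<in> mspan_below c (d + ord x)"
    unfolding mon_x
  proof (rule mspan_below_intros)
    show "mon (Suc a) b \<in> mspan_below c (d + ord x)"
      using ab by (intro mon_in_mspan_below) (auto simp: ord_mon algebra_simps)
    show "of_nat b *\<^sub>W mon a (b - 1) \<in> mspan_below c (d + ord x)"
    \<comment> \<open>For \<open>b = 0\<close> the truncated exponent \<open>b - 1\<close> is
      harmless, since the coefficient is zero.\<close>
    proof (cases b)
      case (Suc b')
      then show ?thesis
        using ab by (intro mspan_below_intros mon_in_mspan_below) (auto simp: ord_mon algebra_simps)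
    qed (simp add: mspan_below_intros)
  qed
qed (auto simp: weyl.subspace_def distrib_right weyl_scale_mult_left intro: mspan_below_intros)

lemma mspan_below_y_mult:
  assumes "u \<in> mspan_below (c + 1) d"
  shows "y * u \<in> mspan_below c (d + ord y)"
proof (rule mspan_below_induct[OF assms, of "{u. y * u \<in> mspan_below c (d + ord y)}", unfolded mem_Collect_eq])
  fix a b assume ab: "of_nat a - of_nat b = c + 1" "ord (mon a b) < d"
  show "y * mon a b \<in> mspan_below c (d + ord y)"
    unfolding y_mon
  proof (rule mspan_below_intros)
    show "mon a (Suc b) \<in> mspan_below c (d + ord y)"
      using ab by (intro mon_in_mspan_below) (auto simp: ord_mon algebra_simps)
    show "of_nat a *\<^sub>W mon (a - 1) b \<in> mspan_below c (d + ord y)"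
    proof (cases a)
      case (Suc a')
      then show ?thesis
        using ab by (intro mspan_below_intros mon_in_mspan_below) (auto simp: ord_mon algebra_simps)
    qed (simp add: mspan_below_intros)
  qed
qed (auto simp: weyl.subspace_def distrib_left weyl_scale_mult_right intro: mspan_below_intros)

text \<open>On monomials \<open>\<delta>\<close> is diagonal with eigenvalues \<open>- b\<close>, so
  the equation is solved by dividing each coefficient by the nonzero scalar
  \<open>e - b\<close>.\<close>

lemma mspan_below_solve:
  assumes "\<And>a b. of_nat a - of_nat b = c \<Longrightarrow> e \<noteq> of_nat b" "m \<in> mspan_below c d"
  shows "\<exists>w\<in>mspan_below c d. \<delta> w + e *\<^sub>W w = m"
proof -
  let ?T = "{m. \<exists>w\<in>mspan_below c d. \<delta> w + e *\<^sub>W w = m}"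
  have "m \<in> ?T"
  proof (rule mspan_below_induct[OF assms(2)])
    show "weyl.subspace ?T"
      unfolding weyl.subspace_def
    proof (intro conjI ballI allI)
      show "0 \<in> ?T" by (auto simp: \<delta>_simps intro!: bexI[of _ 0] mspan_below_intros)
    next
      fix m n assume "m \<in> ?T" "n \<in> ?T"
      then obtain v w where "v \<in> mspan_below c d" "w \<in> mspan_below c d"
        "\<delta> v + e *\<^sub>W v = m" "\<delta> w + e *\<^sub>W w = n" by blast
      then show "m + n \<in> ?T"
        by (auto simp: \<delta>_simps weyl.scale_right_distrib intro!: bexI[of _ "v + w"] mspan_below_intros)
    next
      fix k m assume "m \<in> ?T"
      then obtain v where "v \<in> mspan_below c d" "\<delta> v + e *\<^sub>W v = m" by blast
      then show "k *\<^sub>W m \<in> ?T"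
        by (auto simp: \<delta>_simps weyl.scale_right_distrib weyl.scale_left_commute[of k]
            intro!: bexI[of _ "k *\<^sub>W v"] mspan_below_intros)
    qed
  next
    fix a b assume ab: "of_nat a - of_nat b = c" "ord (mon a b) < d"
    let ?w = "(1 / (e - of_nat b)) *\<^sub>W mon a b"
    have "\<delta> (mon a b) + e *\<^sub>W mon a b = (e - of_nat b) *\<^sub>W mon a b"
      by (simp add: \<delta>_mon weyl.scale_left_diff_distrib)
    then have "\<delta> ?w + e *\<^sub>W ?w = (1 / (e - of_nat b)) *\<^sub>W ((e - of_nat b) *\<^sub>W mon a b)"
      by (metis \<delta>_simps(4) weyl.scale_left_commute weyl.scale_right_distrib)
    also have "\<dots> = mon a b" using assms(1)[OF ab(1)] by simp
    finally show "mon a b \<in> ?T"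
      using ab by (auto intro!: bexI[of _ ?w] mspan_below_intros mon_in_mspan_below)
  qed
  then show ?thesis by simp
qed

section \<open>Descent to eigenvectors of lower order\<close>

lemma commutator_H: "commutator H u = y * commutator x u + commutator y u * x"
  by (simp add: H_def commutator_simps)

lemma ord_H_minus: "ord (H - E *\<^sub>W 1) = ord H" "H - E *\<^sub>W 1 \<noteq> 0"
proof -
  have "cf (1 :: 'k weyl) (ord H) = 0" using one_below by (simp add: below_iff)
  then have "cf (H - E *\<^sub>W 1) (ord H) \<noteq> 0" by simp
  moreover have "H - E *\<^sub>W 1 \<in> below (Suc (ord H))"
    using one_below by (intro below_intros below_Suc_ord) (auto elim: below_mono)
  ultimately show "ord (H - E *\<^sub>W 1) = ord H" by (intro ord_eqI)
  show "H - E *\<^sub>W 1 \<noteq> 0"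
    using \<open>cf (H - E *\<^sub>W 1) (ord H) \<noteq> 0\<close> by (metis cf_simps(1))
qed

text \<open>The assumption turns \<open>x u y\<close> into \<open>(H - 1 - E) u\<close>. Substituted
  into \<open>H u H = y (x u y) x\<close>, this yields \<open>H (H - c) u = (H - E) s\<close>, and
  \<open>H (H - c)\<close> takes the nonzero value \<open>E e\<close> at
  \<open>H = E\<close>.\<close>

lemma eig_\<delta>_divisible:
  assumes u: "u \<in> eig H c" and \<delta>u: "\<delta> u + e *\<^sub>W u = 0" and e: "e \<noteq> 0" "c + e \<noteq> 0"
  obtains v where "v \<in> eig H c" "u = (H - (c + e) *\<^sub>W 1) * v"
proof -
  define E where "E = c + e"
  define s where "s = y * u * x"
  have uH: "u * H = H * u - c *\<^sub>W u"
    using u unfolding eig_iff commutator_def by (metis diff_diff_eq2 add_diff_cancel_left')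
  have yH: "y * H = H * y + y"
    using comm_H_y by (simp add: commutator_def algebra_simps)
  have "x * u * y = \<delta> u + u * (x * y)"
    by (simp add: \<delta>_def commutator_def algebra_simps)
  also have "\<dots> = H * u - u - E *\<^sub>W u"
    using \<delta>u by (simp add: xy E_def right_diff_distrib uH weyl.scale_left_distrib
        eq_neg_iff_add_eq_0[symmetric])
  finally have xuy: "x * u * y = H * u - u - E *\<^sub>W u" .
  have "H * (u * H) = y * (x * u * y) * x"
    by (simp add: H_def mult.assoc)
  also have "\<dots> = y * H * u * x - s - E *\<^sub>W s"
    unfolding xuy by (simp add: s_def right_diff_distrib left_diff_distrib mult.assoc
        weyl_scale_mult_left weyl_scale_mult_right)
  also have "y * H * u * x = H * s + s"
    by (simp add: yH s_def distrib_right mult.assoc)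
  finally have s: "H * (u * H) = H * s - E *\<^sub>W s" by simp
  \<comment> \<open>Division of \<open>H (H - c)\<close> by \<open>H - E\<close> has quotient
    \<open>H + (E - c)\<close> and remainder \<open>E (E - c) = E e\<close>; hence
    \<open>(H - E) t = E e u\<close>.\<close>
  define t where "t = s - H * u - (E - c) *\<^sub>W u"
  have "y * u * x \<in> eig H (- 1 + c + 1)"
    by (intro eig_mult eig_x eig_y u)
  then have "s \<in> eig H c" by (simp add: s_def)
  moreover have "H * u \<in> eig H (0 + c)" by (intro eig_mult eig_self u)
  ultimately have t: "t \<in> eig H c" unfolding t_def using u by (intro eig_intros) simp_all
  have "(H - E *\<^sub>W 1) * t = (H * s - E *\<^sub>W s) - H * (H * u - c *\<^sub>W u) + (E * (E - c)) *\<^sub>W u"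
    by (simp add: t_def right_diff_distrib left_diff_distrib weyl_scale_mult_left
        weyl_scale_mult_right weyl.scale_right_diff_distrib weyl.scale_left_diff_distrib
        mult.commute)
  also have "\<dots> = (E * e) *\<^sub>W u"
    unfolding s[symmetric] uH by (simp add: E_def)
  finally have "(H - E *\<^sub>W 1) * ((1 / (E * e)) *\<^sub>W t) = u"
    using e by (simp add: weyl_scale_mult_right E_def)
  then show thesis
    using t that[of "(1 / (E * e)) *\<^sub>W t"] by (simp add: E_def eig_intros)
qed

lemma eig_mspan_below: "u \<in> eig H c \<Longrightarrow> u \<in> below d \<Longrightarrow> u \<in> mspan_below c d"
proof (induction d arbitrary: u c rule: less_induct)
  case (less D)
  show ?case
  proof (cases "u \<in> below (D - 1) \<or> D = 0")
    case True
    show ?thesis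
    proof (cases "D = 0")
      case False
      with True less show ?thesis
        using mspan_below_mono[of u c "D - 1" D] by simp
    qed (use less.prems in \<open>simp add: mspan_below_intros\<close>)
  next
    case False
    define d where "d = ord u"
    have D: "D = Suc d" and u0: "u \<noteq> 0"
      using False less.prems(2) by (auto simp: below_iff_ord d_def)
    define n :: 'k where "n = of_nat (ord H)"
    have n: "n \<noteq> 0" using ord_H_ge by (simp add: n_def)
    define e where "e = (of_nat d - c * of_nat (ord x)) / n"
    have wt: "wt u e"
      unfolding e_def d_def n_def using less.prems(1) u0 by (rule wt_eig)
    show ?thesis
    proof (cases "\<exists>a b. of_nat a - of_nat b = c \<and> e = of_nat b")
      case True
      then obtain a b where c: "of_nat a - of_nat b = c" and e: "e = of_nat b" by blast
      \<comment> \<open>Reading the exponent formula backwards shows that the monomial has exactly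
        the order of \<open>u\<close>, so it can cancel the leading term.\<close>
      have "of_nat d = of_nat b * n + c * of_nat (ord x)"
        using n e by (simp add: e_def field_simps)
      also have "\<dots> = of_nat (ord (mon a b))"
        by (simp add: ord_mon n_def ord_H algebra_simps flip: c)
      finally have d: "ord (mon a b) = d" by (metis of_nat_eq_iff)
      obtain k where k: "u - k *\<^sub>W mon a b \<in> below d"
        using eig_proportional[OF less.prems(1) _ eig_mon mon_nonzero, of a b]
          less.prems(2) d D by metis
      have "u - k *\<^sub>W mon a b \<in> mspan_below c d"
      proof (rule less.IH)
        show "u - k *\<^sub>W mon a b \<in> eig H c"
          using less.prems(1) eig_mon[of a b] c by (intro eig_intros) simp_all
      qed (use k D in simp_all)
      then have "u - k *\<^sub>W mon a b \<in> mspan_below c D"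
        by (rule mspan_below_mono) (simp add: D)
      moreover have "k *\<^sub>W mon a b \<in> mspan_below c D"
        using c d D by (intro mspan_below_intros mon_in_mspan_below) simp_all
      ultimately have "(u - k *\<^sub>W mon a b) + k *\<^sub>W mon a b \<in> mspan_below c D"
        by (rule mspan_below_intros)
      then show ?thesis by simp
    next
      case False
      \<comment> \<open>By \<open>wt\<close> the defect \<open>m\<close> has lower order and is
        already a combination of monomials. Solving for \<open>w\<close> and passing to
        \<open>u - w\<close> makes the approximate eigenvalue equation for \<open>\<delta>\<close>
        exact.\<close>
      define m where "m = \<delta> u + e *\<^sub>W u"
      have "m \<in> mspan_below c d"
        using wt less.prems(1) D unfolding m_def
        by (intro less.IH eig_intros eig_\<delta>) (simp_all add: wt_def d_def)
      then obtain w where w: "w \<in> mspan_below c d" "\<delta> w + e *\<^sub>W w = m"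
        using mspan_below_solve[of c e m d] False by blast
      define v where "v = u - w"
      have v: "v \<in> eig H c" "v \<in> below D"
        using w(1) mspan_below_subset[of w c d] less.prems D unfolding v_def
        by (auto intro!: eig_intros below_intros elim: below_mono)
      have "\<delta> v + e *\<^sub>W v = m - (\<delta> w + e *\<^sub>W w)"
        by (simp add: v_def m_def \<delta>_simps weyl.scale_right_diff_distrib)
      then have \<delta>v: "\<delta> v + e *\<^sub>W v = 0" using w(2) by simp
      have "v \<in> mspan_below c D"
      proof (cases "v = 0")
        case v0: False
        have ord_v: "ord v < D" using v v0 by (simp add: below_iff_ord)
        have cv: "c *\<^sub>W v = y * commutator x v + commutator y v * x"
          using v(1) commutator_H[of v] by (simp add: eig_iff)
        consider "e = 0" | "e \<noteq> 0" "c + e = 0" | "e \<noteq> 0" "c + e \<noteq> 0" by blast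
        then show ?thesis
        proof cases
          case 1
          \<comment> \<open>If \<open>c\<close> were also zero, the monomial with
            \<open>a = b = 0\<close> would match, contrary to the present case.\<close>
          have "c \<noteq> 0" using False 1 by force
          have "commutator x v = 0" using \<delta>v 1 by (simp add: \<delta>_def)
          define z where "z = commutator y v"
          have zx: "z * x = c *\<^sub>W v"
            using cv \<open>commutator x v = 0\<close> by (simp add: z_def)
          then have "z * x \<noteq> 0" using \<open>c \<noteq> 0\<close> v0 by simp
          moreover have "z * x \<in> below D" unfolding zx using v by (intro below_intros)
          ultimately have "z \<in> below (D - ord x)" "ord x \<le> D"
            by (auto simp: below_iff_ord ord_mult)
          then have "z \<in> mspan_below (c - 1) (D - ord x)"
            using v(1) ord_pos D unfolding z_def by (intro less.IH eig_commutator_y) auto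
          then have "z * x \<in> mspan_below c D"
            using mspan_below_mult_x \<open>ord x \<le> D\<close> by fastforce
          then have "(1 / c) *\<^sub>W (z * x) \<in> mspan_below c D" by (rule mspan_below_intros)
          then show ?thesis using \<open>c \<noteq> 0\<close> by (simp add: zx)
        next
          case 2
          have "c \<noteq> 0" using 2 by auto
          \<comment> \<open>Combining \<open>\<delta> v = c v\<close> with
            \<open>[H, v] = c v\<close> gives \<open>x v y = x y v\<close>; cancelling
            \<open>x\<close> shows that \<open>v\<close> commutes with \<open>y\<close>.\<close>
          have "x * v * y = \<delta> v + v * (x * y)"
            by (simp add: \<delta>_def commutator_def algebra_simps)
          also have "\<delta> v = c *\<^sub>W v"
            using \<delta>v 2 by (simp add: add_eq_0_iff2 eq_neg_iff_add_eq_0[symmetric] weyl.scale_minus_left)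
          also have "c *\<^sub>W v + v * (x * y) = (x * y) * v"
            using v(1) by (simp add: xy eig_iff commutator_def algebra_simps)
          finally have "x * commutator y v = 0"
            by (simp add: commutator_def right_diff_distrib mult.assoc)
          then have "commutator y v = 0" by simp
          define z where "z = commutator x v"
          have yz: "y * z = c *\<^sub>W v"
            using cv \<open>commutator y v = 0\<close> by (simp add: z_def)
          then have "y * z \<noteq> 0" using \<open>c \<noteq> 0\<close> v0 by simp
          moreover have "y * z \<in> below D" unfolding yz using v by (intro below_intros)
          ultimately have "z \<in> below (D - ord y)" "ord y \<le> D"
            by (auto simp: below_iff_ord ord_mult)
          then have "z \<in> mspan_below (c + 1) (D - ord y)"
            using v(1) ord_pos D unfolding z_def by (intro less.IH eig_commutator_x) auto
          then have "y * z \<in> mspan_below c D"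
            using mspan_below_y_mult \<open>ord y \<le> D\<close> by fastforce
          then have "(1 / c) *\<^sub>W (y * z) \<in> mspan_below c D" by (rule mspan_below_intros)
          then show ?thesis using \<open>c \<noteq> 0\<close> by (simp add: yz)
        next
          case 3
          then obtain z where z: "z \<in> eig H c" "v = (H - (c + e) *\<^sub>W 1) * z"
            using eig_\<delta>_divisible[OF v(1) \<delta>v] by blast
          have "z \<noteq> 0" using v0 z(2) by auto
          then have "ord v = ord H + ord z"
            using ord_mult[OF ord_H_minus(2)] by (simp add: z(2) ord_H_minus(1))
          then have "z \<in> below (D - ord H)" "ord H \<le> D" using ord_v by (auto simp: below_iff_ord)
          then have "z \<in> mspan_below c (D - ord H)"
            using z(1) ord_H_ge D by (intro less.IH) auto
          then have "H * z \<in> mspan_below c D" "z \<in> mspan_below c D"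
            using mspan_below_H_mult[of z c "D - ord H"] \<open>ord H \<le> D\<close> by (auto elim: mspan_below_mono)
          then have "H * z - (c + e) *\<^sub>W z \<in> mspan_below c D" by (intro mspan_below_intros)
          then show ?thesis by (simp add: z(2) left_diff_distrib weyl_scale_mult_left)
        qed
      qed (simp add: mspan_below_intros)
      moreover have "w \<in> mspan_below c D" using w(1) D by (auto elim: mspan_below_mono)
      ultimately have "v + w \<in> mspan_below c D" by (intro mspan_below_intros)
      then show ?thesis by (simp add: v_def)
    qed
  qed
qed

end

section \<open>Eigenspaces, eigenvalues and the eigenvector algebra\<close>

context weyl_pair
begin

lemma eig_H_eq_mspan: "eig H c = mspan c"
proof
  show "eig H c \<subseteq> mspan c"
  proof (cases "ord H \<le> 1")
    case True
    then show ?thesis using eig_mspan_small by blast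
  next
    case False
    then interpret weyl_pair_high x y by unfold_locales simp
    have "mspan_below c d \<subseteq> mspan c" for d
      unfolding mspan_below_def mspan_def by (intro weyl.span_mono) blast
    then show ?thesis using eig_mspan_below below_Suc_ord by blast
  qed
qed (rule mspan_subset_eig)

definition KH :: "'k weyl set"
  where "KH = generated_subalgebra {H}"

lemma KH: "weyl_subalgebra KH" "H \<in> KH"
  unfolding KH_def by (rule weyl_subalgebra_generated) (simp add: generated_subalgebra_def hull_inc)

lemma KH_closed:
  "1 \<in> KH" "0 \<in> KH" "p \<in> KH \<Longrightarrow> q \<in> KH \<Longrightarrow> p + q \<in> KH"
  "p \<in> KH \<Longrightarrow> q \<in> KH \<Longrightarrow> p * q \<in> KH" "p \<in> KH \<Longrightarrow> k *\<^sub>W p \<in> KH"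
  "p \<in> KH \<Longrightarrow> q \<in> KH \<Longrightarrow> p - q \<in> KH"
  using KH(1) weyl.subspace_diff by (auto simp: weyl_subalgebra_def weyl.subspace_def)

lemma KH_subset_eig: "KH \<subseteq> eig H 0"
  unfolding KH_def generated_subalgebra_def
proof (rule hull_minimal)
  show "weyl_subalgebra (eig H 0)"
    using eig_mult[of _ H 0 _ 0] by (auto simp: weyl_subalgebra_def subspace_eig eig_intros)
qed (simp add: eig_self)

lemma mon_Suc_Suc: "mon (Suc a) (Suc b) = (H - of_nat (Suc a) *\<^sub>W 1) * mon a b"
  using H_mon[of a b] by (simp add: left_diff_distrib weyl_scale_mult_left del: of_nat_Suc)

text \<open>By \<open>mon_Suc_Suc\<close>, one \<open>x\<close> and one \<open>y\<close> at a time
  are traded for a factor in \<open>H\<close> on the left, until only a pure power of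
  \<open>x\<close> or of \<open>y\<close> remains.\<close>

lemma mon_eq_KH_mult:
  "\<exists>p\<in>KH. mon a b = p * v' x y (int a - int b)"
proof (induction a arbitrary: b)
  case 0
  have "mon 0 b = 1 * v' x y (int 0 - int b)"
    by (cases "b = 0") (simp_all add: mon_def v'_def)
  then show ?case using KH_closed(1) by blast
next
  case (Suc a)
  show ?case
  proof (cases b)
    case 0
    have "mon (Suc a) b = 1 * v' x y (int (Suc a) - int b)"
      using 0 by (simp add: mon_def v'_def nat_add_distrib nat_int_add del: power_Suc flip: of_nat_Suc)
    then show ?thesis using KH_closed(1) by blast
  next
    case (Suc b')
    obtain p where "p \<in> KH" "mon a b' = p * v' x y (int a - int b')"
      using Suc.IH by blast
    then have "mon (Suc a) b = ((H - of_nat (Suc a) *\<^sub>W 1) * p) * v' x y (int (Suc a) - int b)"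
      by (simp add: Suc mon_Suc_Suc mult.assoc del: of_nat_Suc) simp
    moreover have "(H - of_nat (Suc a) *\<^sub>W 1) * p \<in> KH"
      using \<open>p \<in> KH\<close> by (intro KH_closed KH(2))
    ultimately show ?thesis by blast
  qed
qed

text \<open>Since \<open>nat\<close> sends negative integers to 0, at least one of the two exponents
  is 0.\<close>

lemma v'_eq_mon: "v' x y i = mon (nat i) (nat (- i))"
  by (simp add: v'_def mon_def)

lemma v'_in_eig: "v' x y i \<in> eig H (of_int i)"
proof -
  have "of_nat (nat i) - of_nat (nat (- i)) = (of_int i :: 'k)"
    by (cases "i \<ge> 0") simp_all
  then show ?thesis using eig_mon[of "nat i" "nat (- i)"] by (simp add: v'_eq_mon)
qed

lemma eig_H_of_int: "eig H (of_int i) = {p * v' x y i | p. p \<in> KH}"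
proof
  show "{p * v' x y i | p. p \<in> KH} \<subseteq> eig H (of_int i)"
    using KH_subset_eig eig_mult[OF _ v'_in_eig[of i], of _ 0] by auto
  have "weyl.subspace {p * v' x y i | p. p \<in> KH}"
    unfolding weyl.subspace_def
  proof (intro conjI ballI allI)
    show "0 \<in> {p * v' x y i | p. p \<in> KH}" using KH_closed(2) by force
  next
    fix u v assume "u \<in> {p * v' x y i | p. p \<in> KH}" "v \<in> {p * v' x y i | p. p \<in> KH}"
    then show "u + v \<in> {p * v' x y i | p. p \<in> KH}"
      using KH_closed(3) by (force simp flip: distrib_right)
  next
    fix k u assume "u \<in> {p * v' x y i | p. p \<in> KH}"
    then show "k *\<^sub>W u \<in> {p * v' x y i | p. p \<in> KH}"
      using KH_closed(5) by (force simp flip: weyl_scale_mult_left)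
  qed
  moreover have "mon a b \<in> {p * v' x y i | p. p \<in> KH}" if "of_nat a - of_nat b = (of_int i :: 'k)" for a b
  proof -
    have "of_int (int a - int b) = (of_int i :: 'k)" using that by simp
    then have "int a - int b = i" by (simp only: of_int_eq_iff)
    then show ?thesis using mon_eq_KH_mult[of a b] by auto
  qed
  ultimately show "eig H (of_int i) \<subseteq> {p * v' x y i | p. p \<in> KH}"
    unfolding eig_H_eq_mspan mspan_def by (intro weyl.span_minimal) auto
qed

lemma eigenvalues_H: "eigenvalues (commutator H) = \<int>"
proof
  show "eigenvalues (commutator H) \<subseteq> \<int>"
  proof
    fix c assume "c \<in> eigenvalues (commutator H)"
    then obtain u where u: "u \<noteq> 0" "u \<in> mspan c"
      unfolding eig_H_eq_mspan[symmetric] by (auto simp: eigenvalues_def eigenvector_def eig_iff)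
    \<comment> \<open>An empty generating set would span only zero, so a nonzero eigenvector forces
      \<open>c\<close> to be a difference of natural numbers.\<close>
    then have "{mon a b | a b. of_nat a - of_nat b = c} \<noteq> {}"
      unfolding mspan_def by (metis weyl.span_empty singletonD)
    then obtain a b where "of_nat a - of_nat b = c" by auto
    then show "c \<in> \<int>" by (metis Ints_diff Ints_of_nat)
  qed
  show "\<int> \<subseteq> eigenvalues (commutator H)"
  proof
    fix c :: 'k assume "c \<in> \<int>"
    then obtain i where i: "c = of_int i" by (rule Ints_cases)
    have "v' x y i \<noteq> 0" by (simp add: v'_eq_mon mon_nonzero)
    then show "c \<in> eigenvalues (commutator H)"
      using v'_in_eig[of i] by (auto simp: eigenvalues_def eigenvector_def eig_iff i)
  qed
qed

lemma eigenvector_algebra_H: "eigenvector_algebra H = generated_subalgebra {x, y}"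
proof
  have sub: "weyl_subalgebra (generated_subalgebra {x, y})"
    by (rule weyl_subalgebra_generated)
  have gen: "x \<in> generated_subalgebra {x, y}" "y \<in> generated_subalgebra {x, y}"
    by (simp_all add: generated_subalgebra_def hull_inc)
  have power: "v ^ k \<in> generated_subalgebra {x, y}" if "v \<in> generated_subalgebra {x, y}" for v k
    using that sub by (induction k) (auto simp: weyl_subalgebra_def)
  have "mon a b \<in> generated_subalgebra {x, y}" for a b
    using sub power[OF gen(1)] power[OF gen(2)] by (auto simp: mon_def weyl_subalgebra_def)
  then have "mspan c \<subseteq> generated_subalgebra {x, y}" for c
    unfolding mspan_def using sub by (intro weyl.span_minimal) (auto simp: weyl_subalgebra_def)
  then have "{u. \<exists>c. eigenvector (commutator H) c u} \<subseteq> generated_subalgebra {x, y}"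
    unfolding eig_H_eq_mspan[symmetric] by (force simp: eigenvector_def eig_iff)
  then show "eigenvector_algebra H \<subseteq> generated_subalgebra {x, y}"
    unfolding eigenvector_algebra_def generated_subalgebra_def[of "{u. _ u}"]
    using sub by (intro hull_minimal) auto
  have "{x, y} \<subseteq> {u. \<exists>c. eigenvector (commutator H) c u}"
  proof -
    have "eigenvector (commutator H) 1 x" "eigenvector (commutator H) (- 1) y"
      using eig_x eig_y by (simp_all add: eigenvector_def eig_iff)
    then show ?thesis by blast
  qed
  then show "generated_subalgebra {x, y} \<subseteq> eigenvector_algebra H"
    unfolding eigenvector_algebra_def generated_subalgebra_def by (rule hull_mono)
qed

end

theorem theorem1p2:
  fixes x y :: "'k::field_char_0 weyl"
  assumes "commutator y x = 1"
  shows "eigenvector_algebra (y * x) = generated_subalgebra {x, y} \<and>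
    eigenvalues (ad (y * x)) = \<int> \<and>
    (\<forall>i::int. {u. ad (y * x) u = of_int i *\<^sub>W u} =
      {p * v' x y i | p. p \<in> generated_subalgebra {y * x}})"
proof -
  interpret weyl_pair x y by standard (rule assms)
  show ?thesis
    using eigenvector_algebra_H eigenvalues_H eig_H_of_int
    unfolding H_def KH_def eig_def by blast
qed

end
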